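(* Let $n$ be an odd number, $h_n:=(n-1)/2$, $1\le\ell\le h_n$, and let $T\in\mathcal{BC}^1(V_n)$ be such that its components $T_i$, $i=1,\dots,n$, have real spectra. Then the polyharmonic functional calculus based on the $S$-spectrum is well defined: for every left (resp. right) slice hyperholomorphic function $f$ and every bounded slice Cauchy domain $U$ with $\sigma_S(T)\subset U$ and $\overline U\subset\mathrm{dom}(f)$, the integral $$\tilde f(T):=\frac1{2\pi}\int_{\partial(U\cap\mathbb C_I)}\mathbf H_\ell(s,T)\,ds_I\,f(s)\qquad\Big(\text{resp. }\ \tilde f(T):=\frac1{2\pi}\int_{\partial(U\cap\mathbb C_I)}f(s)\,ds_I\,\mathbf H_\ell(s,T)\Big)$$ depends neither on the imaginary unit $I\in\mathbb S$ nor on the choice of such a slice Cauchy domain $U$.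
   Context: $\mathbb R_n$ is the real Clifford algebra generated by $e_1,\dots,e_n$ with $e_ie_j+e_je_i=-2\delta_{ij}$. A point $(x_0,\dots,x_n)\in\mathbb R^{n+1}$ is identified with the paravector $x=x_0+\underline x$, $\underline x=\sum_{j=1}^n x_je_j$ (with $e_0=1$). $\mathbb S$ is the set of $\underline x$ with $|\underline x|=1$; for $I\in\mathbb S$, $\mathbb C_I=\mathbb R+I\mathbb R$. $[x]=\{x_0+I|\underline x|: I\in\mathbb S\}$. An open $U\subset\mathbb R^{n+1}$ is axially symmetric if $[x]\subset U$ for all $x\in U$; it is a slice Cauchy domain if it is axially symmetric and, for every $I\in\mathbb S$, $\partial(U\cap\mathbb C_I)$ is a finite union of non-intersecting piecewise continuously differentiable Jordan curves in $\mathbb C_I$ (positively oriented). $ds_I=ds(-I)$. For $U$ axially symmetric open let $\mathcal U=\{(u,v)\in\mathbb R^2: u+\mathbb S v\subset U\}$. $f:U\to\mathbb R_n$ is left (resp. right) slice hyperholomorphic if $f(u+Iv)=\alpha(u,v)+I\beta(u,v)$ (resp. $\alpha(u,v)+\beta(u,v)I$) for all $I\in\mathbb S$, $(u,v)\in\mathcal U$, with differentiable $\alpha,\beta:\mathcal U\to\mathbb R_n$ satisfying $\alpha(u,-v)=\alpha(u,v)$, $\beta(u,-v)=-\beta(u,v)$ and $\partial_u\alpha=\partial_v\beta$, $\partial_v\alpha=-\partial_u\beta$. The domain $\mathrm{dom}(f)$ is an axially symmetric open set. $V$ is a real Banach space, $\mathcal B(V)$ its bounded linear operators, $V_n=V\otimes\mathbb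 R_n$ the two-sided Banach $\mathbb R_n$-module, $\mathcal B(V_n)$ the set of $\sum_A T_Ae_A$, $T_A\in\mathcal B(V)$, with $(\sum_AT_Ae_A)(\sum_Bv_Be_B)=\sum_{A,B}T_A(v_B)e_Ae_B$ and norm $\sum_A\|T_A\|$; $\mathbb R_n$ is embedded via $a\mapsto\mathcal I a$. $\mathcal{BC}^{0,1}(V_n)$ is the set of $T=\sum_{\mu=0}^ne_\mu T_\mu$ with pairwise commuting $T_\mu\in\mathcal B(V)$; $\mathcal{BC}^1(V_n)$ is the subset with $T_0=0$. $\overline T=T_0-\sum_{\mu\ge1}e_\mu T_\mu$. $\sigma_S(T)$ is the set of $s\in\mathbb R^{n+1}$ such that $T^2-2s_0T+|s|^2\mathcal I$ is not invertible in $\mathcal B(V_n)$ (equivalently, for commuting components, $\mathcal Q_{c,s}(T):=s^2\mathcal I-s(T+\overline T)+T\overline T$ is not invertible in $\mathcal B(V_n)$); $\rho_S(T)=\mathbb R^{n+1}\setminus\sigma_S(T)$. The spectrum of $T_i$ is the usual one (in the complexification of $V$). For $s\in\rho_S(T)$: $\mathbf H_\ell(s,T)=\sigma_{n,\ell}\,\mathcal Q_{c,s}(T)^{-\ell}$, $\sigma_{n,\ell}=2^{2\ell-1}(\ell-1)!\,(-h_n)_\ell$, $(-h_n)_\ell=(-1)^\ell\frac{h_n!}{(h_n-\ell)!}$. Here $\tilde f$ denotes $D\Delta_{n+1}^{\ell-1}f$ (resp. $fD\Delta_{n+1}^{\ell-1}$) with $D=\partial_{x_0}+\sum_ie_i\partial_{x_i}$.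 *)

theory Defs
  imports "HOL-Complex_Analysis.Complex_Analysis"
begin

section \<open>Clifford algebras\<close>

text \<open>The coefficients \<open>x $ A\<close>, for \<open>A\<close> a set of indices, are taken with respect to the basis
  \<open>e\<^sub>A = e\<^sub>i\<^sub>1 \<dots> e\<^sub>i\<^sub>k\<close>, where \<open>A = {i\<^sub>1 < \<dots> < i\<^sub>k}\<close>; thus \<open>n = CARD('n)\<close>,
  \<open>e\<^sub>{\<^sub>} = 1\<close>, and the real Clifford algebra is \<open>real ^ ('n set)\<close>. In
  \<open>e\<^sub>A e\<^sub>B = \<plusminus> e\<^sub>C\<close>, with \<open>C\<close> the symmetric difference, each inversion and each
  repeated generator contributes a factor \<open>-1\<close>.\<close>

type_synonym 'n rvec = "(real, 'n) vec"
type_synonym 'n point = "real \<times> (real, 'n) vec"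
type_synonym 'n clifford = "(real, 'n set) vec"
type_synonym ('v, 'n) cliff_op = "('v \<Rightarrow>\<^sub>L 'v, 'n set) vec"

definition basis_sign :: "'n::linorder set \<Rightarrow> 'n set \<Rightarrow> real" where
  "basis_sign A B = (-1) ^ (card {(a, b). a \<in> A \<and> b \<in> B \<and> b < a} + card (A \<inter> B))"

text \<open>The bilinear map \<open>m\<close> multiplies coefficients, so that
  \<open>(\<Sum>\<^sub>A x\<^sub>A e\<^sub>A) (\<Sum>\<^sub>B y\<^sub>B e\<^sub>B) = (\<Sum>\<^sub>A\<^sub>,\<^sub>B m x\<^sub>A y\<^sub>B e\<^sub>A e\<^sub>B)\<close>.\<close>

definition cliff_mult ::
  "('a \<Rightarrow> 'b \<Rightarrow> 'c::real_vector) \<Rightarrow> 'a ^ ('n::{finite,linorder} set) \<Rightarrow> 'b ^ ('n set) \<Rightarrow> 'c ^ ('n set)"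
  where
  "cliff_mult m x y =
     (\<chi> C. \<Sum>(A, B) | (A - B) \<union> (B - A) = C. basis_sign A B *\<^sub>R m (x $ A) (y $ B))"

abbreviation cmul ::
  "'n::{finite,linorder} clifford \<Rightarrow> 'n clifford \<Rightarrow> 'n clifford" (infixl "\<star>" 70) where
  "x \<star> y \<equiv> cliff_mult (*) x y"

lemma cliff_mult_axis:
  "axis A a \<star> axis B b = axis ((A - B) \<union> (B - A)) (basis_sign A B * a * b)"
proof -
  have "(axis A a \<star> axis B b) $ C = axis ((A - B) \<union> (B - A)) (basis_sign A B * a * b) $ C" for C
  proof -
    have "(axis A a \<star> axis B b) $ C =
        (\<Sum>p | (fst p - snd p) \<union> (snd p - fst p) = C.
           if p = (A, B) then basis_sign A B * a * b else 0)"
      unfolding cliff_mult_def vec_lambda_beta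
      by (rule sum.cong) (auto simp: axis_def case_prod_beta)
    also have "\<dots> = axis ((A - B) \<union> (B - A)) (basis_sign A B * a * b) $ C"
      by (simp add: axis_def eq_commute[of C])
    finally show ?thesis .
  qed
  then show ?thesis by (simp add: vec_eq_iff)
qed

lemma clifford_relations:
  fixes i j :: "'n::{finite,linorder}"
  shows "axis {i} 1 \<star> axis {j} 1 + axis {j} 1 \<star> axis {i} 1 = axis {} (if i = j then -2 else 0)"
proof -
  have inv: "{(a, b). a = i \<and> b = j \<and> b < a} = (if j < i then {(i, j)} else {})" for i j :: 'n
    by auto
  have ax: "axis A x + axis A y = axis A (x + y)" for A :: "'n set" and x y :: real
    by (simp add: vec_eq_iff axis_def)
  show ?thesis
  proof (cases "i = j")
    case True
    then show ?thesis by (simp add: cliff_mult_axis basis_sign_def inv ax)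
  next
    case False
    then have "i < j \<or> j < i" by auto
    with False have s: "basis_sign {i} {j} + basis_sign {j} {i} = 0"
      by (auto simp: basis_sign_def inv)
    have "({j} - {i}) \<union> ({i} - {j}) = ({i} - {j}) \<union> ({j} - {i})" by auto
    with False s show ?thesis by (simp only: cliff_mult_axis ax) (simp add: axis_def)
  qed
qed

text \<open>Points of \<open>\<real>\<^sup>n\<^sup>+\<^sup>1\<close> are pairs of a scalar and a vector part.\<close>

definition paravec :: "'n::{finite,linorder} point \<Rightarrow> 'n clifford" where
  "paravec x = axis {} (fst x) + (\<Sum>i\<in>UNIV. axis {i} (snd x $ i))"


section \<open>Axial symmetry and slice hyperholomorphic functions\<close>

text \<open>The imaginary units \<open>\<S>\<close> form \<open>sphere 0 1\<close> in \<open>real ^ 'n\<close>. The plane \<open>\<complex>\<^sub>I\<close> is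
  parametrised by \<open>u + \<i>v \<mapsto> u + Iv\<close>.\<close>

definition slice_pt :: "'n::{finite,linorder} rvec \<Rightarrow> complex \<Rightarrow> 'n point" where
  "slice_pt I z = (Re z, Im z *\<^sub>R I)"

definition slice :: "'n::{finite,linorder} rvec \<Rightarrow> 'n point set \<Rightarrow> complex set" where
  "slice I U = {z. slice_pt I z \<in> U}"

definition axial_class :: "'n::{finite,linorder} point \<Rightarrow> 'n point set" where
  "axial_class x = {(fst x, norm (snd x) *\<^sub>R I) | I. I \<in> sphere 0 1}"

definition axially_symmetric :: "'n::{finite,linorder} point set \<Rightarrow> bool" where
  "axially_symmetric U \<longleftrightarrow> (\<forall>x\<in>U. axial_class x \<subseteq> U)"

definition planar :: "'n::{finite,linorder} point set \<Rightarrow> (real \<times> real) set" where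
  "planar U = {(u, v). \<forall>I\<in>sphere 0 1. (u, v *\<^sub>R I) \<in> U}"

definition cr_pair ::
  "'n::{finite,linorder} point set \<Rightarrow> (real \<times> real \<Rightarrow> 'n clifford) \<Rightarrow>
   (real \<times> real \<Rightarrow> 'n clifford) \<Rightarrow> bool" where
  "cr_pair U \<alpha> \<beta> \<longleftrightarrow>
     (\<forall>(u, v)\<in>planar U.
        \<alpha> differentiable (at (u, v)) \<and> \<beta> differentiable (at (u, v)) \<and>
        \<alpha> (u, -v) = \<alpha> (u, v) \<and> \<beta> (u, -v) = - \<beta> (u, v) \<and>
        frechet_derivative \<alpha> (at (u, v)) (1, 0) = frechet_derivative \<beta> (at (u, v)) (0, 1) \<and>
        frechet_derivative \<alpha> (at (u, v)) (0, 1) = - frechet_derivative \<beta> (at (u, v)) (1, 0))"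

definition left_slice_hyperholomorphic ::
  "'n::{finite,linorder} point set \<Rightarrow> ('n point \<Rightarrow> 'n clifford) \<Rightarrow> bool" where
  "left_slice_hyperholomorphic U f \<longleftrightarrow>
     open U \<and> axially_symmetric U \<and>
     (\<exists>\<alpha> \<beta>. cr_pair U \<alpha> \<beta> \<and>
        (\<forall>I\<in>sphere 0 1. \<forall>(u, v)\<in>planar U.
           f (u, v *\<^sub>R I) = \<alpha> (u, v) + paravec (0, I) \<star> \<beta> (u, v)))"

definition right_slice_hyperholomorphic ::
  "'n::{finite,linorder} point set \<Rightarrow> ('n point \<Rightarrow> 'n clifford) \<Rightarrow> bool" where
  "right_slice_hyperholomorphic U f \<longleftrightarrow>
     open U \<and> axially_symmetric U \<and>
     (\<exists>\<alpha> \<beta>. cr_pair U \<alpha> \<beta> \<and>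
        (\<forall>I\<in>sphere 0 1. \<forall>(u, v)\<in>planar U.
           f (u, v *\<^sub>R I) = \<alpha> (u, v) + \<beta> (u, v) \<star> paravec (0, I)))"


section \<open>Slice Cauchy domains\<close>

definition jordan_boundary :: "(real \<Rightarrow> complex) set \<Rightarrow> complex set \<Rightarrow> bool" where
  "jordan_boundary \<Gamma> D \<longleftrightarrow>
     finite \<Gamma> \<and>
     (\<forall>\<gamma>\<in>\<Gamma>. simple_path \<gamma> \<and> pathfinish \<gamma> = pathstart \<gamma> \<and> valid_path \<gamma>) \<and>
     pairwise (\<lambda>\<gamma> \<delta>. disjnt (path_image \<gamma>) (path_image \<delta>)) \<Gamma> \<and>
     frontier D = (\<Union>\<gamma>\<in>\<Gamma>. path_image \<gamma>)"

definition slice_cauchy_domain :: "'n::{finite,linorder} point set \<Rightarrow> bool" where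
  "slice_cauchy_domain U \<longleftrightarrow>
     open U \<and> axially_symmetric U \<and> (\<forall>I\<in>sphere 0 1. \<exists>\<Gamma>. jordan_boundary \<Gamma> (slice I U))"

text \<open>For bounded \<open>D\<close> with \<open>jordan_boundary \<Gamma> D\<close>, this says that \<open>D\<close> lies to the left of
  each of its boundary curves.\<close>

definition positively_oriented :: "(real \<Rightarrow> complex) set \<Rightarrow> complex set \<Rightarrow> bool" where
  "positively_oriented \<Gamma> D \<longleftrightarrow>
     (\<forall>z\<in>D. (\<Sum>\<gamma>\<in>\<Gamma>. winding_number \<gamma> z) = 1) \<and>
     (\<forall>z. z \<notin> closure D \<longrightarrow> (\<Sum>\<gamma>\<in>\<Gamma>. winding_number \<gamma> z) = 0)"


section \<open>Operators\<close>

text \<open>An element \<open>\<Sum>\<^sub>A T\<^sub>A e\<^sub>A\<close> of \<open>\<B>(V\<^sub>n)\<close> is the family of its components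
  \<open>T\<^sub>A \<in> \<B>(V)\<close>, which its action on \<open>V \<subseteq> V\<^sub>n\<close> determines; composition of operators on
  \<open>V\<^sub>n\<close> becomes \<open>\<odot>\<close>. The library norm of this product space is equivalent to
  \<open>\<Sum>\<^sub>A \<parallel>T\<^sub>A\<parallel>\<close>, so integrals are the same for both.\<close>

abbreviation omul ::
  "('v::real_normed_vector, 'n::{finite,linorder}) cliff_op \<Rightarrow> ('v, 'n) cliff_op \<Rightarrow>
   ('v, 'n) cliff_op" (infixl "\<odot>" 70) where
  "S \<odot> T \<equiv> cliff_mult (o\<^sub>L) S T"

definition emb ::
  "'n::{finite,linorder} clifford \<Rightarrow> ('v::real_normed_vector, 'n) cliff_op" where
  "emb a = (\<chi> A. a $ A *\<^sub>R id_blinfun)"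

abbreviation op_one :: "('v::real_normed_vector, 'n::{finite,linorder}) cliff_op" where
  "op_one \<equiv> emb (axis {} 1)"

definition is_op_inverse ::
  "('v::real_normed_vector, 'n::{finite,linorder}) cliff_op \<Rightarrow> ('v, 'n) cliff_op \<Rightarrow> bool"
  where
  "is_op_inverse T S \<longleftrightarrow> T \<odot> S = op_one \<and> S \<odot> T = op_one"

definition op_invertible ::
  "('v::real_normed_vector, 'n::{finite,linorder}) cliff_op \<Rightarrow> bool" where
  "op_invertible T \<longleftrightarrow> (\<exists>S. is_op_inverse T S)"

definition op_inv ::
  "('v::real_normed_vector, 'n::{finite,linorder}) cliff_op \<Rightarrow> ('v, 'n) cliff_op" where
  "op_inv T = (THE S. is_op_inverse T S)"

definition op_power ::
  "('v::real_normed_vector, 'n::{finite,linorder}) cliff_op \<Rightarrow> nat \<Rightarrow> ('v, 'n) cliff_op"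
  where
  "op_power T k = ((\<lambda>S. T \<odot> S) ^^ k) op_one"

text \<open>The components of \<open>T = T\<^sub>0 + \<Sum>\<^sub>i e\<^sub>i T\<^sub>i\<close> are \<open>T\<^sub>0 = T $ {}\<close> and \<open>T\<^sub>i = T $ {i}\<close>.\<close>

definition BC01 :: "('v::real_normed_vector, 'n::{finite,linorder}) cliff_op set" where
  "BC01 = {T. (\<forall>A. 2 \<le> card A \<longrightarrow> T $ A = 0) \<and>
              (\<forall>A B. T $ A o\<^sub>L T $ B = T $ B o\<^sub>L T $ A)}"

definition BC1 :: "('v::real_normed_vector, 'n::{finite,linorder}) cliff_op set" where
  "BC1 = {T \<in> BC01. T $ {} = 0}"

text \<open>Clifford conjugation, on operators of the form \<open>T\<^sub>0 + \<Sum>\<^sub>i e\<^sub>i T\<^sub>i\<close> only.\<close>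

definition op_conj ::
  "('v::real_normed_vector, 'n::{finite,linorder}) cliff_op \<Rightarrow> ('v, 'n) cliff_op" where
  "op_conj T = (\<chi> A. if A = {} then T $ A else - (T $ A))"

definition S_spectrum ::
  "('v::real_normed_vector, 'n::{finite,linorder}) cliff_op \<Rightarrow> 'n point set" where
  "S_spectrum T =
     {s. \<not> op_invertible (T \<odot> T - (2 * fst s) *\<^sub>R T + (norm s)\<^sup>2 *\<^sub>R op_one)}"

definition Qc ::
  "'n::{finite,linorder} point \<Rightarrow> ('v::real_normed_vector, 'n) cliff_op \<Rightarrow>
   ('v, 'n) cliff_op" where
  "Qc s T = emb (paravec s \<star> paravec s) - emb (paravec s) \<odot> (T + op_conj T) + T \<odot> op_conj T"

text \<open>The complexification of \<open>V\<close> is \<open>V \<times> V\<close>, where \<open>(x, y)\<close> stands for \<open>x + \<i>y\<close>;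
  \<open>shifted_op z T\<close> is \<open>z\<I> - T\<close> on it. As it is complex linear, so is its inverse.\<close>

definition shifted_op :: "complex \<Rightarrow> ('v::real_normed_vector \<Rightarrow>\<^sub>L 'v) \<Rightarrow> 'v \<times> 'v \<Rightarrow> 'v \<times> 'v" where
  "shifted_op z T = (\<lambda>(x, y). (Re z *\<^sub>R x - Im z *\<^sub>R y - blinfun_apply T x,
                               Im z *\<^sub>R x + Re z *\<^sub>R y - blinfun_apply T y))"

definition op_spectrum :: "('v::real_normed_vector \<Rightarrow>\<^sub>L 'v) \<Rightarrow> complex set" where
  "op_spectrum T =
     {z. \<not> (\<exists>S. bounded_linear S \<and> S \<circ> shifted_op z T = id \<and> shifted_op z T \<circ> S = id)}"


section \<open>The polyharmonic functional calculus\<close>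

definition hn :: "'n::{finite,linorder} itself \<Rightarrow> nat" where
  "hn _ = (CARD('n) - 1) div 2"

definition sigma_const :: "'n::{finite,linorder} itself \<Rightarrow> nat \<Rightarrow> real" where
  "sigma_const N l = 2 ^ (2 * l - 1) * fact (l - 1) * pochhammer (- real (hn N)) l"

definition H_kernel ::
  "nat \<Rightarrow> 'n::{finite,linorder} point \<Rightarrow> ('v::real_normed_vector, 'n) cliff_op \<Rightarrow>
   ('v, 'n) cliff_op" where
  "H_kernel l s T = sigma_const TYPE('n) l *\<^sub>R op_power (op_inv (Qc s T)) l"

text \<open>Along \<open>s = \<gamma>(t)\<close>, read in \<open>\<complex>\<^sub>I\<close>, the differential \<open>ds\<^sub>I = ds (-I)\<close> is the following
  times \<open>dt\<close>.\<close>

definition dsI :: "'n::{finite,linorder} rvec \<Rightarrow> (real \<Rightarrow> complex) \<Rightarrow> real \<Rightarrow> 'n clifford" where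
  "dsI I \<gamma> t =
     paravec (slice_pt I (vector_derivative \<gamma> (at t within {0..1}))) \<star> - paravec (0, I)"

definition left_integrand ::
  "nat \<Rightarrow> ('v::real_normed_vector, 'n::{finite,linorder}) cliff_op \<Rightarrow>
   ('n point \<Rightarrow> 'n clifford) \<Rightarrow> 'n rvec \<Rightarrow> (real \<Rightarrow> complex) \<Rightarrow> real \<Rightarrow>
   ('v, 'n) cliff_op" where
  "left_integrand l T f I \<gamma> t =
     H_kernel l (slice_pt I (\<gamma> t)) T \<odot> emb (dsI I \<gamma> t) \<odot> emb (f (slice_pt I (\<gamma> t)))"

definition right_integrand ::
  "nat \<Rightarrow> ('v::real_normed_vector, 'n::{finite,linorder}) cliff_op \<Rightarrow>
   ('n point \<Rightarrow> 'n clifford) \<Rightarrow> 'n rvec \<Rightarrow> (real \<Rightarrow> complex) \<Rightarrow> real \<Rightarrow>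
   ('v, 'n) cliff_op" where
  "right_integrand l T f I \<gamma> t =
     emb (f (slice_pt I (\<gamma> t))) \<odot> emb (dsI I \<gamma> t) \<odot> H_kernel l (slice_pt I (\<gamma> t)) T"

definition left_calculus ::
  "nat \<Rightarrow> ('v::real_normed_vector, 'n::{finite,linorder}) cliff_op \<Rightarrow>
   ('n point \<Rightarrow> 'n clifford) \<Rightarrow> 'n rvec \<Rightarrow> (real \<Rightarrow> complex) set \<Rightarrow>
   ('v, 'n) cliff_op" where
  "left_calculus l T f I \<Gamma> =
     (1 / (2 * pi)) *\<^sub>R (\<Sum>\<gamma>\<in>\<Gamma>. integral {0..1} (left_integrand l T f I \<gamma>))"

definition right_calculus ::
  "nat \<Rightarrow> ('v::real_normed_vector, 'n::{finite,linorder}) cliff_op \<Rightarrow>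
   ('n point \<Rightarrow> 'n clifford) \<Rightarrow> 'n rvec \<Rightarrow> (real \<Rightarrow> complex) set \<Rightarrow>
   ('v, 'n) cliff_op" where
  "right_calculus l T f I \<Gamma> =
     (1 / (2 * pi)) *\<^sub>R (\<Sum>\<gamma>\<in>\<Gamma>. integral {0..1} (right_integrand l T f I \<gamma>))"

text \<open>\<open>\<Gamma>\<close> parametrises the positively oriented boundary of \<open>U \<inter> \<complex>\<^sub>I\<close>, for a domain \<open>U\<close>
  admissible for \<open>T\<close> and for a function with domain \<open>W\<close>.\<close>

definition admissible ::
  "('v::real_normed_vector, 'n::{finite,linorder}) cliff_op \<Rightarrow> 'n point set \<Rightarrow>
   'n point set \<Rightarrow> 'n rvec \<Rightarrow> (real \<Rightarrow> complex) set \<Rightarrow> bool" where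
  "admissible T W U I \<Gamma> \<longleftrightarrow>
     bounded U \<and> slice_cauchy_domain U \<and> S_spectrum T \<subseteq> U \<and> closure U \<subseteq> W \<and>
     I \<in> sphere 0 1 \<and> jordan_boundary \<Gamma> (slice I U) \<and> positively_oriented \<Gamma> (slice I U)"

end

theory Submission
  imports Defs
begin

text \<open>Put \<open>B = \<Sum>\<^sub>i T\<^sub>i\<^sup>2\<close>. Since \<open>T \<in> BC1\<close>, one has \<open>T\<^sup>2 = - B\<close> and
  \<open>Q\<^sub>c\<^sub>,\<^sub>s(T) = s\<^sup>2 + B\<close>. Hence the kernel on \<open>\<complex>\<^sub>I\<close> is, up to a constant, the image of the holomorphic
  function \<open>z \<mapsto> (z\<^sup>2 + B)\<^sup>-\<^sup>l\<close> with values in the complexification of \<open>\<B>(V)\<close> under the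
  homomorphism \<open>\<i> \<mapsto> I\<close>. Expanding \<open>f\<close> in the basis \<open>e\<^sub>A\<close>, the calculus becomes a sum over \<open>A\<close> of
  integrals of intrinsic holomorphic functions that do not involve \<open>I\<close>. Cauchy's theorem for cycles
  makes them independent of \<open>U\<close>; conjugation symmetry makes them purely imaginary, and after
  multiplication by \<open>-\<i>\<close> they are mapped into \<open>\<B>(V) \<subseteq> \<B>(V\<^sub>n)\<close> independently of \<open>I\<close>.

  Cauchy's theorem for cycles is proved by Dixon's argument for scalar functions, and extended to
  Banach space values by the Hahn--Banach theorem. That \<open>z\<^sup>2 + B\<close> is invertible outside the
  \<open>S\<close>-spectrum follows because the grade involution maps \<open>a - bT\<close> to \<open>a + bT\<close> for \<open>a\<close> a polynomial
  in \<open>B\<close> and \<open>b\<close> real, while \<open>(a - bT)(a + bT)\<close> has its coefficients in \<open>\<B>(V)\<close>.\<close>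

section \<open>The Hahn--Banach theorem\<close>

text \<open>The kernel and the values of \<open>f\<close> do not commute, and two admissible
  contours may lie in different planes and bound regions of different shape. The first difficulty is
  met by splitting off the noncommuting part: a left function has coefficients \<alpha>_A + I
  \<beta>_A standing to the left of \<open>e_A\<close>, next to \<open>ds_I\<close> and the kernel,
  so everything except \<open>e_A\<close> lies in the image of one complex algebra; for right
  functions the order is mirrored. As to the second, slices may be disconnected or have holes, so
  contours are compared only by their winding numbers at points where the integrand is not
  holomorphic: 1 at the singularities of the kernel inside the domain of \<open>f\<close>, all of
  which lie in every \<open>U\<close>, and 0 outside that domain. This prescription mentions neither
  \<open>U\<close> nor \<open>I\<close>. The factor -\<i> that makes \<open>I\<close> disappear is
  the one in \<open>ds_I = ds (-I)\<close>.\<close>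

definition sublinear :: "('a::real_vector \<Rightarrow> real) \<Rightarrow> bool" where
  "sublinear p \<longleftrightarrow> (\<forall>x y. p (x + y) \<le> p x + p y) \<and> (\<forall>c>0. \<forall>x. p (c *\<^sub>R x) \<le> c * p x)"

lemma sublinear_scale:
  assumes "sublinear p" "0 \<le> c"
  shows "p (c *\<^sub>R x) = c * p x"
proof -
  have le: "p (c *\<^sub>R x) \<le> c * p x" if "c > 0" for c x
    using assms that by (auto simp: sublinear_def)
  \<comment> \<open>Scaling 0 by 2 gives \<open>0 \<le> p 0\<close>, scaling it by 1/2 gives
    \<open>p 0 \<le> 0\<close>.\<close>
  have p0: "p 0 = 0" using le[of 2 0] le[of "1/2" 0] by simp
  show ?thesis
  proof (cases "c = 0")
    case False
    then have c: "c > 0" using assms by simp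
    from le[of "inverse c" "c *\<^sub>R x"] c have "p x \<le> inverse c * p (c *\<^sub>R x)" by simp
    with c have "c * p x \<le> p (c *\<^sub>R x)" by (simp add: field_simps)
    with le[OF c] show ?thesis by (simp add: order_antisym)
  qed (simp add: p0)
qed

lemma sublinear_neg_le:
  assumes "sublinear p"
  shows "- p (- x) \<le> p x"
proof -
  have "p (x + - x) \<le> p x + p (- x)" using assms unfolding sublinear_def by blast
  with sublinear_scale[OF assms, of 0 0] show ?thesis by simp
qed

text \<open>The witness is the infimum of \<open>p (x + t *\<^sub>R y) - t * p y\<close> over
  \<open>t \<ge> 0\<close>: \<open>t = 0\<close> gives \<open>q \<le> p\<close>,
  \<open>t = 1\<close> the last bound. At \<open>x = - y\<close> that bound reads
  \<open>q (- y) \<le> - p y\<close>, so a linear functional below \<open>q\<close> is at least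
  \<open>p y\<close> at \<open>y\<close>.\<close>

lemma sublinear_tilt:
  assumes p: "sublinear p"
  shows "\<exists>q. sublinear q \<and> q \<le> p \<and> (\<forall>x. q x \<le> p (x + y) - p y)"
proof -
  define q where "q x = (INF t\<in>{0..}. p (x + t *\<^sub>R y) - t * p y)" for x
  have sub: "p (a + b) \<le> p a + p b" for a b using p by (simp add: sublinear_def)
  have "- p (- x) \<le> p (x + t *\<^sub>R y) - t * p y" if "t \<ge> 0" for x t
    using sub[of "x + t *\<^sub>R y" "- x"] sublinear_scale[OF p that] by simp
  then have bd: "bdd_below ((\<lambda>t. p (x + t *\<^sub>R y) - t * p y) ` {0..})" for x
    by (intro bdd_belowI2[of _ "- p (- x)"]) auto
  have le: "q x \<le> p (x + t *\<^sub>R y) - t * p y" if "t \<ge> 0" for x t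
    unfolding q_def using that by (intro cINF_lower bd) auto
  have ge: "m \<le> q x" if "\<And>t. t \<ge> 0 \<Longrightarrow> m \<le> p (x + t *\<^sub>R y) - t * p y" for m x
    unfolding q_def using that by (intro cINF_greatest) auto
  have "q (a + b) \<le> q a + q b" for a b
  proof -
    \<comment> \<open>The parameter \<open>t + s\<close> at \<open>a + b\<close> is dominated by
      \<open>t\<close> at \<open>a\<close> plus \<open>s\<close> at \<open>b\<close>; the infima
      over \<open>t\<close> and \<open>s\<close> are then taken one after the other.\<close>
    have "q (a + b) - (p (b + s *\<^sub>R y) - s * p y) \<le> q a" if "s \<ge> 0" for s
    proof (rule ge)
      fix t :: real assume "t \<ge> 0"
      with le[of "t + s" "a + b"] that sub[of "a + t *\<^sub>R y" "b + s *\<^sub>R y"]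
      show "q (a + b) - (p (b + s *\<^sub>R y) - s * p y) \<le> p (a + t *\<^sub>R y) - t * p y"
        by (simp add: algebra_simps)
    qed
    then have "q (a + b) - q a \<le> q b" by (intro ge) (simp add: algebra_simps)
    then show ?thesis by simp
  qed
  moreover have "q (c *\<^sub>R x) \<le> c * q x" if c: "c > 0" for c x
  proof -
    have "q (c *\<^sub>R x) / c \<le> q x"
    proof (rule ge)
      fix t :: real assume t: "t \<ge> 0"
      have "q (c *\<^sub>R x) \<le> p (c *\<^sub>R (x + t *\<^sub>R y)) - c * t * p y"
        using le[of "c * t" "c *\<^sub>R x"] t c by (simp add: scaleR_add_right)
      also have "\<dots> = c * (p (x + t *\<^sub>R y) - t * p y)"
        using sublinear_scale[OF p, of c "x + t *\<^sub>R y"] c by (simp add: right_diff_distrib)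
      finally show "q (c *\<^sub>R x) / c \<le> p (x + t *\<^sub>R y) - t * p y"
        using c by (simp add: field_simps)
    qed
    then show ?thesis using c by (simp add: field_simps)
  qed
  ultimately have "sublinear q" by (auto simp: sublinear_def)
  moreover have "q \<le> p" using le[of 0] by (simp add: le_fun_def)
  moreover have "\<forall>x. q x \<le> p (x + y) - p y" using le[of 1] by simp
  ultimately show ?thesis by blast
qed

text \<open>A minimal sublinear functional agrees with all its tilts, hence is additive.\<close>

lemma linear_below_sublinear:
  fixes p0 :: "'a::real_vector \<Rightarrow> real"
  assumes p0: "sublinear p0"
  shows "\<exists>f. linear f \<and> f \<le> p0"
proof -
  define A where "A = {p::'a \<Rightarrow> real. sublinear p \<and> p \<le> p0}"
  have "\<exists>m\<in>A. \<forall>a\<in>A. a \<le> m \<longrightarrow> a = m"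
  \<comment> \<open>The order is reversed, so Zorn's lemma yields a minimal element; the bound of a
    chain is its pointwise infimum, and \<open>p0\<close> for the empty chain.\<close>
  proof (rule predicate_Zorn)
    show "partial_order_on A (relation_of (\<lambda>x y. y \<le> x) A)"
      by (rule partial_order_on_relation_ofI) auto
    fix C assume "C \<in> Chains (relation_of (\<lambda>x y. y \<le> x) A)"
    then have CA: "C \<subseteq> A" and ch: "\<And>p q. p \<in> C \<Longrightarrow> q \<in> C \<Longrightarrow> p \<le> q \<or> q \<le> p"
      unfolding Chains_def relation_of_def by auto
    show "\<exists>u\<in>A. \<forall>a\<in>C. u \<le> a"
    proof (cases "C = {}")
      case True
      then show ?thesis using p0 by (auto simp: A_def)
    next
      case False
      define u where "u x = (INF p\<in>C. p x)" for x
      have "- p0 (- x) \<le> p x" if "p \<in> C" for p x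
        using sublinear_neg_le[of p x] that CA
        by (smt (verit, best) A_def le_fun_def mem_Collect_eq subsetD)
      then have bd: "bdd_below ((\<lambda>p. p x) ` C)" for x
        by (intro bdd_belowI2[of _ "- p0 (- x)"]) auto
      have le: "u x \<le> p x" if "p \<in> C" for p x
        unfolding u_def using that by (intro cINF_lower bd) auto
      have ge: "m \<le> u x" if "\<And>p. p \<in> C \<Longrightarrow> m \<le> p x" for m x
        unfolding u_def using that False by (intro cINF_greatest) auto
      have "u (a + b) \<le> u a + u b" for a b
      proof -
        have "u (a + b) - q b \<le> u a" if q: "q \<in> C" for q
        proof (rule ge)
          fix p assume p: "p \<in> C"
          \<comment> \<open>Only a chain has a subadditive infimum: the smaller of \<open>p\<close>
            and \<open>q\<close> serves at both \<open>a\<close> and \<open>b\<close>.\<close>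
          have "\<exists>r\<in>C. r \<le> p \<and> r \<le> q" using ch[OF p q] p q by auto
          then obtain r where r: "r \<in> C" "r \<le> p" "r \<le> q" by blast
          have "u (a + b) \<le> r (a + b)" using le r by blast
          also have "\<dots> \<le> r a + r b" using r CA by (auto simp: A_def sublinear_def)
          also have "\<dots> \<le> p a + q b" using r by (intro add_mono) (auto simp: le_fun_def)
          finally show "u (a + b) - q b \<le> p a" by simp
        qed
        then have "u (a + b) - u a \<le> u b" by (intro ge) (simp add: algebra_simps)
        then show ?thesis by simp
      qed
      moreover have "u (c *\<^sub>R x) \<le> c * u x" if c: "c > 0" for c x
      proof -
        have "u (c *\<^sub>R x) / c \<le> u x"
        proof (rule ge)
          fix p assume p: "p \<in> C"
          have "u (c *\<^sub>R x) \<le> p (c *\<^sub>R x)" by (rule le[OF p])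
          also have "\<dots> \<le> c * p x" using p CA c by (auto simp: A_def sublinear_def)
          finally show "u (c *\<^sub>R x) / c \<le> p x" using c by (simp add: field_simps)
        qed
        then show ?thesis using c by (simp add: field_simps)
      qed
      ultimately have "sublinear u" by (auto simp: sublinear_def)
      moreover have "u \<le> p0"
      proof -
        obtain p where "p \<in> C" using False by blast
        then show ?thesis using le[of p] CA by (force simp: A_def le_fun_def intro: order_trans)
      qed
      ultimately show ?thesis using le by (auto simp: A_def le_fun_def)
    qed
  qed
  then obtain m where m: "sublinear m" "m \<le> p0"
    and min: "\<And>a. sublinear a \<Longrightarrow> a \<le> m \<Longrightarrow> a = m"
    by (auto simp: A_def intro: order_trans)
  have add: "m (x + y) = m x + m y" for x y
  proof -
    obtain q where "sublinear q" "q \<le> m" "q x \<le> m (x + y) - m y"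
      using sublinear_tilt[OF m(1)] by blast
    with min have "m x \<le> m (x + y) - m y" by blast
    with m(1) show ?thesis by (simp add: sublinear_def order_antisym)
  qed
  have neg: "m (- x) = - m x" for x
    using add[of x "- x"] sublinear_scale[OF m(1), of 0 0] by simp
  have "m (c *\<^sub>R x) = c * m x" for c x
    using sublinear_scale[OF m(1), of c x] sublinear_scale[OF m(1), of "- c" x] neg[of "c *\<^sub>R x"]
    by (cases "c \<ge> 0") auto
  with add have "linear m" by (simp add: linear_iff)
  with m show ?thesis by blast
qed

text \<open>Tilting the norm at \<open>x\<close> gives \<open>q\<close> with
  \<open>q (- x) \<le> - norm x\<close>. A linear functional below \<open>q\<close> is bounded by
  the norm and takes a value of at least \<open>norm x\<close> at \<open>x\<close>; if that value is
  0, so is \<open>x\<close>.\<close>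

theorem bounded_linear_functional_separates:
  fixes x :: "'a::real_normed_vector"
  assumes "\<And>\<phi>::'a \<Rightarrow> real. bounded_linear \<phi> \<Longrightarrow> \<phi> x = 0"
  shows "x = 0"
proof -
  have "sublinear (norm :: 'a \<Rightarrow> real)" by (auto simp: sublinear_def norm_triangle_ineq)
  then obtain q :: "'a \<Rightarrow> real" where q: "sublinear q" "q \<le> norm" "q (- x) \<le> - norm x"
    using sublinear_tilt[of norm x] by (metis add.left_inverse diff_0 norm_zero)
  then obtain f where f: "linear f" "f \<le> q" using linear_below_sublinear by blast
  have "f y \<le> norm y" for y using f q by (meson le_funD order_trans)
  from this this[of "- y" for y] have "\<bar>f y\<bar> \<le> norm y" for y
    using f(1) by (simp add: linear_neg abs_le_iff)
  with f(1) have "bounded_linear f"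
    by (auto simp: bounded_linear_def bounded_linear_axioms_def intro!: exI[of _ 1])
  then have "f x = 0" by (rule assms)
  moreover have "f (- x) \<le> - norm x" using f(2) q(3) by (meson le_funD order_trans)
  ultimately show ?thesis using f(1) by (simp add: linear_neg)
qed

section \<open>Cauchy's theorem for cycles\<close>

text \<open>A polynomial path has a continuous, hence bounded, derivative on [0,1]. Therefore a
  merely continuous \<open>f\<close> gives an integrable Cauchy kernel, and one may differentiate in
  \<open>z\<close> under the integral.\<close>

lemma Cauchy_type_integral_holomorphic:
  assumes p: "polynomial_function p" and f: "continuous_on (path_image p) f"
  shows "(\<lambda>z. contour_integral p (\<lambda>w. f w / (w - z))) holomorphic_on - path_image p"
    and "\<And>z. z \<notin> path_image p \<Longrightarrow> (\<lambda>w. f w / (w - z)) contour_integrable_on p"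
    and "((\<lambda>z. contour_integral p (\<lambda>w. f w / (w - z))) \<longlongrightarrow> 0) at_infinity"
proof -
  obtain p' where p': "polynomial_function p'" "\<And>x. (p has_vector_derivative p' x) (at x)"
    using has_vector_derivative_polynomial_function[OF p] by blast
  have vp: "valid_path p" and pp: "path p"
    using p by (auto simp: valid_path_polynomial_function path_polynomial_function)
  have "compact (p' ` {0..1})"
    using p'(1) by (intro compact_continuous_image continuous_on_polymonial_function) auto
  then obtain B where "B > 0" and B: "\<And>t. t \<in> {0..1} \<Longrightarrow> norm (p' t) \<le> B"
    using compact_imp_bounded bounded_pos by (metis imageI)
  have vd: "vector_derivative p (at t) = p' t" for t
    using p'(2) by (rule vector_derivative_at)
  have vd01: "vector_derivative p (at t within {0..1}) = p' t" if "t \<in> {0..1}" for t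
    using that p'(2) by (intro vector_derivative_at_within_ivl) auto
  have p'c: "continuous_on {0..1} p'" by (rule continuous_on_polymonial_function[OF p'(1)])
  have pc: "continuous_on {0..1} p" by (rule continuous_on_polymonial_function[OF p])
  have int: "(\<lambda>w. g w / (w - z)) contour_integrable_on p"
    if g: "continuous_on (path_image p) g" and z: "z \<notin> path_image p" for g z
  proof -
    have "continuous_on {0..1} (\<lambda>t. g (p t) / (p t - z) * p' t)"
      using z by (intro continuous_intros p'c pc continuous_on_compose2[OF g pc])
        (auto simp: path_image_def)
    then have "(\<lambda>t. g (p t) / (p t - z) * p' t) integrable_on {0..1}"
      by (rule integrable_continuous_real)
    then show ?thesis
      unfolding contour_integrable_on by (simp add: vd)
  qed
  then show "\<And>z. z \<notin> path_image p \<Longrightarrow> (\<lambda>w. f w / (w - z)) contour_integrable_on p"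
    using f by blast
  have "(\<lambda>z. contour_integral p (\<lambda>w. f w / (w - z))) field_differentiable at z"
    if z: "z \<in> UNIV - path_image p" for z
  proof -
    have "((\<lambda>u. f u / (u - w) ^ 1) has_contour_integral contour_integral p (\<lambda>u. f u / (u - w))) p"
      if "w \<in> UNIV - path_image p" for w
      using int[OF f] that by (simp add: has_contour_integral_integral)
    from Cauchy_next_derivative(2)[OF f _ this, of B] show ?thesis
      using z B vp by (force simp: field_differentiable_def vd)
  qed
  then show "(\<lambda>z. contour_integral p (\<lambda>w. f w / (w - z))) holomorphic_on - path_image p"
    by (simp add: holomorphic_on_def field_differentiable_at_within)
  show "((\<lambda>z. contour_integral p (\<lambda>w. f w / (w - z))) \<longlongrightarrow> 0) at_infinity"
  proof (rule Lim_at_infinityI)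
    fix e :: real assume e: "e > 0"
    obtain C where "C > 0" and C: "\<And>w. w \<in> path_image p \<Longrightarrow> norm w \<le> C"
      using bounded_path_image[OF pp] bounded_pos by metis
    obtain M where "M > 0" and M: "\<And>w. w \<in> path_image p \<Longrightarrow> norm (f w) \<le> M"
      using compact_imp_bounded[OF compact_continuous_image[OF f compact_path_image[OF pp]]]
        bounded_pos by (metis imageI)
    \<comment> \<open>\<open>C\<close> bounds the path, so every point of it is at distance at least
      \<open>M * B / e + 1\<close> from \<open>z\<close>; this keeps \<open>z\<close> off the path
      and the integrand, whose numerator is at most \<open>M * B\<close>, below
      \<open>e\<close>.\<close>
    have "dist (contour_integral p (\<lambda>w. f w / (w - z))) 0 \<le> e"
      if z: "C + M * B / e + 1 \<le> norm z" for z
    proof -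
      have gap: "M * B / e + 1 \<le> norm (w - z)" if "w \<in> path_image p" for w
        using z C[OF that] norm_triangle_ineq2[of z w] by (simp add: norm_minus_commute)
      have MB: "M * B / e \<ge> 0" using \<open>M > 0\<close> \<open>B > 0\<close> e by simp
      have zn: "z \<notin> path_image p" using gap[of z] MB by auto
      have "norm (f (p t) / (p t - z) * vector_derivative p (at t within {0..1})) \<le> e"
        if t: "t \<in> cbox 0 1" for t
      proof -
        have pt: "p t \<in> path_image p" using t by (auto simp: path_image_def)
        have "M * B \<le> e * norm (p t - z)"
          using gap[OF pt] e MB by (simp add: field_simps)
        moreover have "norm (f (p t)) * norm (p' t) \<le> M * B"
          using M[OF pt] B[of t] t \<open>M > 0\<close> by (intro mult_mono) auto
        moreover have "norm (p t - z) > 0" using gap[OF pt] MB by linarith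
        ultimately show ?thesis using t
          by (simp add: vd01 norm_mult norm_divide divide_le_eq)
      qed
      moreover have "((\<lambda>t. f (p t) / (p t - z) * vector_derivative p (at t within {0..1})) has_integral
          contour_integral p (\<lambda>w. f w / (w - z))) (cbox 0 1)"
        using has_contour_integral_integral[OF int[OF f zn]] by (simp add: has_contour_integral_def)
      ultimately have "norm (contour_integral p (\<lambda>w. f w / (w - z))) \<le> e * measure lborel (cbox 0 (1::real))"
        using e by (intro has_integral_bound) auto
      then show ?thesis by simp
    qed
    then show "\<exists>b. \<forall>z. b \<le> norm z \<longrightarrow> dist (contour_integral p (\<lambda>w. f w / (w - z))) 0 \<le> e"
      by blast
  qed
qed

text \<open>The image of a polynomial path is negligible, so a small translation moves it off \<open>z\<close>.\<close>

lemma polynomial_loop_nearby: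
  assumes S: "open S" and \<gamma>: "valid_path \<gamma>" "path_image \<gamma> \<subseteq> S" "pathfinish \<gamma> = pathstart \<gamma>"
  obtains p where "polynomial_function p" "pathfinish p = pathstart p" "path_image p \<subseteq> S"
    "z \<notin> path_image p" "\<And>f. f holomorphic_on S \<Longrightarrow> contour_integral p f = contour_integral \<gamma> f"
proof -
  have "path \<gamma>" using \<gamma> valid_path_imp_path by blast
  from contour_integral_nearby_loops[OF S this \<gamma>(2)] obtain d where d: "d > 0" and
    near: "\<And>g h. valid_path g \<Longrightarrow> valid_path h \<Longrightarrow>
      (\<forall>t\<in>{0..1}. norm (g t - \<gamma> t) < d \<and> norm (h t - \<gamma> t) < d) \<Longrightarrow>
      pathfinish g = pathstart g \<Longrightarrow> pathfinish h = pathstart h \<Longrightarrow>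
      path_image h \<subseteq> S \<and> (\<forall>f. f holomorphic_on S \<longrightarrow> contour_integral h f = contour_integral g f)"
    by metis
  obtain p where p: "polynomial_function p" "pathstart p = pathstart \<gamma>" "pathfinish p = pathfinish \<gamma>"
    "\<And>t. t \<in> {0..1} \<Longrightarrow> norm (p t - \<gamma> t) < d / 2"
    using path_approx_polynomial_function[OF \<open>path \<gamma>\<close>, of "d / 2"] d by auto
  have "negligible (p ` {0..1})"
    using p(1) by (intro negligible_differentiable_image_lowdim)
      (auto simp: differentiable_on_polynomial_function)
  then have "\<not> ball z (d / 2) \<subseteq> p ` {0..1}"
    using d by (meson half_gt_zero negligible_subset open_ball open_not_negligible ball_eq_empty not_le)
  then obtain c where c: "dist z c < d / 2" "c \<notin> p ` {0..1}" by (auto simp: subset_eq)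
  \<comment> \<open>\<open>q\<close> meets \<open>z\<close> exactly where \<open>p\<close> meets
    \<open>c\<close>, that is, nowhere. Approximation and translation each use up half of
    \<open>d\<close>.\<close>
  define q where "q t = p t + (z - c)" for t
  have q: "polynomial_function q"
    unfolding q_def using p(1) by (intro polynomial_function_add) auto
  have close: "norm (q t - \<gamma> t) < d" if "t \<in> {0..1}" for t
  proof -
    have "norm (q t - \<gamma> t) \<le> norm (p t - \<gamma> t) + norm (z - c)"
      unfolding q_def by (metis add_diff_eq add.commute diff_add_eq norm_triangle_ineq)
    with p(4)[OF that] c(1) show ?thesis by (simp add: dist_norm)
  qed
  have loop: "pathfinish q = pathstart q"
    using p \<gamma>(3) by (simp add: q_def pathfinish_def pathstart_def)
  have "z \<notin> path_image q" using c(2) by (auto simp: q_def path_image_def)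
  with near[OF \<gamma>(1) valid_path_polynomial_function[OF q] _ \<gamma>(3) loop] close q loop d show thesis
    by (intro that[of q]) auto
qed

text \<open>Dixon's function \<open>h\<close> integrates the difference quotient of \<open>f\<close>
  when \<open>z\<close> lies in \<open>S\<close>, and the Cauchy kernel otherwise. The two
  expressions differ by a multiple of the weighted winding number, so they fit together to an entire
  function; it tends to 0 at infinity and vanishes by Liouville.\<close>

lemma Cauchy_type_integral_cycle_zero:
  fixes c :: "'j \<Rightarrow> complex"
  assumes S: "open S" and f: "f holomorphic_on S" and J: "finite J"
    and \<gamma>: "\<And>j. j \<in> J \<Longrightarrow> polynomial_function (\<gamma> j)"
      "\<And>j. j \<in> J \<Longrightarrow> path_image (\<gamma> j) \<subseteq> S" "\<And>j. j \<in> J \<Longrightarrow> pathfinish (\<gamma> j) = pathstart (\<gamma> j)"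
    and zero: "\<And>z. z \<notin> S \<Longrightarrow> (\<Sum>j\<in>J. c j * winding_number (\<gamma> j) z) = 0"
    and z: "z \<notin> S"
  shows "(\<Sum>j\<in>J. c j * contour_integral (\<gamma> j) (\<lambda>w. f w / (w - z))) = 0"
proof -
  \<comment> \<open>The value on the diagonal removes the singularity, so \<open>d z\<close> is
    holomorphic on all of \<open>S\<close>.\<close>
  define d where "d z w = (if w = z then deriv f z else (f w - f z) / (w - z))" for z w
  define h where "h z = (\<Sum>j\<in>J. c j * (if z \<in> S then contour_integral (\<gamma> j) (d z)
      else contour_integral (\<gamma> j) (\<lambda>w. f w / (w - z))))" for z
  have hol_d: "d z holomorphic_on S" for z
    unfolding d_def using pole_lemma_open[OF f S] .
  have fc: "continuous_on A f" if "A \<subseteq> S" for A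
    using f that holomorphic_on_imp_continuous_on continuous_on_subset by blast
  have split: "contour_integral p (d z) = contour_integral p (\<lambda>w. f w / (w - z))
      - f z * contour_integral p (\<lambda>w. 1 / (w - z))"
    if p: "polynomial_function p" "path_image p \<subseteq> S" "z \<notin> path_image p" for p z
  proof -
    have "contour_integral p (d z) = contour_integral p (\<lambda>w. f w / (w - z) - f z * (1 / (w - z)))"
      using p(3) by (intro contour_integral_cong) (auto simp: d_def diff_divide_distrib)
    also have "\<dots> = contour_integral p (\<lambda>w. f w / (w - z))
        - contour_integral p (\<lambda>w. f z * (1 / (w - z)))"
      by (intro contour_integral_diff contour_integrable_lmul
          Cauchy_type_integral_holomorphic(2)[OF p(1) fc[OF p(2)] p(3)]
          Cauchy_type_integral_holomorphic(2)[OF p(1) continuous_on_const p(3)])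
    also have "contour_integral p (\<lambda>w. f z * (1 / (w - z))) = f z * contour_integral p (\<lambda>w. 1 / (w - z))"
      by (intro contour_integral_lmul
          Cauchy_type_integral_holomorphic(2)[OF p(1) continuous_on_const p(3)])
    finally show ?thesis .
  qed
  have wn: "contour_integral (\<gamma> j) (\<lambda>w. 1 / (w - z)) = 2 * pi * \<i> * winding_number (\<gamma> j) z"
    if "j \<in> J" "z \<notin> path_image (\<gamma> j)" for j z
    using has_contour_integral_winding_number[of "\<gamma> j" z] that \<gamma>(1)
    by (simp add: valid_path_polynomial_function contour_integral_unique)
  have h_off: "h z = (\<Sum>j\<in>J. c j * contour_integral (\<gamma> j) (\<lambda>w. f w / (w - z)))"
    if off: "\<And>j. j \<in> J \<Longrightarrow> z \<notin> path_image (\<gamma> j)"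
      and zero: "(\<Sum>j\<in>J. c j * winding_number (\<gamma> j) z) = 0" for z
  proof (cases "z \<in> S")
    case True
    then have "h z = (\<Sum>j\<in>J. c j * contour_integral (\<gamma> j) (\<lambda>w. f w / (w - z))
        - f z * (2 * pi * \<i>) * (c j * winding_number (\<gamma> j) z))"
      unfolding h_def using off \<gamma> by (intro sum.cong) (auto simp: split wn algebra_simps)
    also have "\<dots> = (\<Sum>j\<in>J. c j * contour_integral (\<gamma> j) (\<lambda>w. f w / (w - z)))"
      by (simp add: sum_subtractf flip: sum_distrib_left) (simp add: zero)
    finally show ?thesis .
  qed (simp add: h_def)
  have "h field_differentiable (at z0)" for z0
  proof (cases "z0 \<in> S")
    case True
    \<comment> \<open>\<open>z0\<close> may lie on the cycle itself. Integrals of \<open>d z\<close>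
      do not change if the loops are replaced by loops in \<open>S\<close> that avoid
      \<open>z0\<close>, and near \<open>z0\<close> the difference quotient then splits into Cauchy
      integrals.\<close>
    have "\<exists>p. polynomial_function p \<and> path_image p \<subseteq> S \<and> z0 \<notin> path_image p \<and>
        (\<forall>f. f holomorphic_on S \<longrightarrow> contour_integral p f = contour_integral (\<gamma> j) f)"
      if "j \<in> J" for j
      using polynomial_loop_nearby[OF S valid_path_polynomial_function[OF \<gamma>(1)] \<gamma>(2,3), of j z0] that
      by metis
    then obtain p where p: "\<And>j. j \<in> J \<Longrightarrow> polynomial_function (p j)"
      "\<And>j. j \<in> J \<Longrightarrow> path_image (p j) \<subseteq> S" "\<And>j. j \<in> J \<Longrightarrow> z0 \<notin> path_image (p j)"
      "\<And>j f. j \<in> J \<Longrightarrow> f holomorphic_on S \<Longrightarrow> contour_integral (p j) f = contour_integral (\<gamma> j) f"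
      by metis
    define U where "U = S - (\<Union>j\<in>J. path_image (p j))"
    have U: "open U" "z0 \<in> U"
      using S J p True unfolding U_def
      by (auto intro!: open_Diff closed_UN closed_path_image path_polynomial_function)
    have "(\<lambda>z. \<Sum>j\<in>J. c j * (contour_integral (p j) (\<lambda>w. f w / (w - z))
        - f z * contour_integral (p j) (\<lambda>w. 1 / (w - z)))) holomorphic_on U"
      using p f by (intro holomorphic_intros holomorphic_on_subset[OF f]
          holomorphic_on_subset[OF Cauchy_type_integral_holomorphic(1)] fc) (auto simp: U_def)
    moreover have "h z = (\<Sum>j\<in>J. c j * (contour_integral (p j) (\<lambda>w. f w / (w - z))
        - f z * contour_integral (p j) (\<lambda>w. 1 / (w - z))))" if "z \<in> U" for z
    proof -
      have "contour_integral (\<gamma> j) (d z) = contour_integral (p j) (\<lambda>w. f w / (w - z))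
          - f z * contour_integral (p j) (\<lambda>w. 1 / (w - z))" if j: "j \<in> J" for j
        using split[OF p(1,2)[OF j], of z] p(4)[OF j hol_d, of z] \<open>z \<in> U\<close> j by (auto simp: U_def)
      then show ?thesis using that unfolding h_def U_def by (intro sum.cong) auto
    qed
    ultimately have "h holomorphic_on U" by (simp cong: holomorphic_cong)
    with U show ?thesis by (simp add: holomorphic_on_imp_differentiable_at)
  next
    case False
    \<comment> \<open>Winding numbers are locally constant, so their weighted sum is 0 near
      \<open>z0\<close> also at points of \<open>S\<close>; there both formulas for \<open>h\<close>
      agree.\<close>
    define U where "U = (\<Inter>j\<in>J. {z. z \<notin> path_image (\<gamma> j)
        \<and> winding_number (\<gamma> j) z = winding_number (\<gamma> j) z0})"
    have U: "open U" "z0 \<in> U"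
      using J \<gamma> False unfolding U_def
      by (auto intro!: open_INT open_winding_number_levelsets path_polynomial_function)
    have "(\<lambda>z. \<Sum>j\<in>J. c j * contour_integral (\<gamma> j) (\<lambda>w. f w / (w - z))) holomorphic_on U"
      using \<gamma> by (intro holomorphic_intros
          holomorphic_on_subset[OF Cauchy_type_integral_holomorphic(1)] fc) (auto simp: U_def)
    moreover have "h z = (\<Sum>j\<in>J. c j * contour_integral (\<gamma> j) (\<lambda>w. f w / (w - z)))" if "z \<in> U" for z
      using that zero[OF False] by (intro h_off) (auto simp: U_def)
    ultimately have "h holomorphic_on U" by (simp cong: holomorphic_cong)
    with U show ?thesis by (simp add: holomorphic_on_imp_differentiable_at)
  qed
  then have "h holomorphic_on UNIV" by (simp add: holomorphic_on_def)
  moreover have "(h \<longlongrightarrow> 0) at_infinity"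
  proof -
    have "\<forall>\<^sub>F z in at_infinity. z \<notin> path_image (\<gamma> j) \<and> winding_number (\<gamma> j) z = 0" if j: "j \<in> J" for j
    proof -
      have pj: "path (\<gamma> j)" using \<gamma>(1)[OF j] by (rule path_polynomial_function)
      obtain B where "\<And>z. B \<le> norm z \<Longrightarrow> winding_number (\<gamma> j) z = 0"
        using winding_number_zero_at_infinity[OF pj \<gamma>(3)[OF j]] by blast
      moreover obtain C where "\<And>w. w \<in> path_image (\<gamma> j) \<Longrightarrow> norm w \<le> C"
        using bounded_path_image[OF pj] bounded_pos by metis
      ultimately show ?thesis
        unfolding eventually_at_infinity by (intro exI[of _ "max B (C + 1)"]) fastforce
    qed
    then have "\<forall>\<^sub>F z in at_infinity. \<forall>j\<in>J. z \<notin> path_image (\<gamma> j) \<and> winding_number (\<gamma> j) z = 0"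
      using J by (simp add: eventually_ball_finite)
    then have ev: "\<forall>\<^sub>F z in at_infinity. (\<Sum>j\<in>J. c j * contour_integral (\<gamma> j) (\<lambda>w. f w / (w - z))) = h z"
      by eventually_elim (rule h_off[symmetric], auto)
    have "((\<lambda>z. \<Sum>j\<in>J. c j * contour_integral (\<gamma> j) (\<lambda>w. f w / (w - z))) \<longlongrightarrow> (\<Sum>j\<in>J. c j * 0)) at_infinity"
      using \<gamma> by (intro tendsto_intros Cauchy_type_integral_holomorphic(3) fc)
    then show ?thesis using tendsto_cong[OF ev] by simp
  qed
  ultimately have "h z = 0" by (rule Liouville_weak)
  with z show ?thesis by (simp add: h_def)
qed

text \<open>The preceding lemma is applied to \<open>f w * (w - a)\<close> at a point
  \<open>a\<close> outside \<open>S\<close>, where the Cauchy kernel cancels the factor. If there is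
  no such point, \<open>S\<close> is the whole plane and Cauchy's theorem for convex sets
  applies.\<close>

theorem Cauchy_theorem_cycle:
  fixes c :: "'j \<Rightarrow> complex"
  assumes S: "open S" and f: "f holomorphic_on S" and J: "finite J"
    and \<gamma>: "\<And>j. j \<in> J \<Longrightarrow> valid_path (\<gamma> j)"
      "\<And>j. j \<in> J \<Longrightarrow> path_image (\<gamma> j) \<subseteq> S" "\<And>j. j \<in> J \<Longrightarrow> pathfinish (\<gamma> j) = pathstart (\<gamma> j)"
    and zero: "\<And>z. z \<notin> S \<Longrightarrow> (\<Sum>j\<in>J. c j * winding_number (\<gamma> j) z) = 0"
  shows "(\<Sum>j\<in>J. c j * contour_integral (\<gamma> j) f) = 0"
proof (cases "S = UNIV")
  case True
  then have "contour_integral (\<gamma> j) f = 0" if "j \<in> J" for j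
    using Cauchy_theorem_convex_simple[of f UNIV "\<gamma> j"] f \<gamma> that by (simp add: contour_integral_unique)
  then show ?thesis by simp
next
  case False
  then obtain a where a: "a \<notin> S" by blast
  have "\<exists>p. polynomial_function p \<and> path_image p \<subseteq> S \<and> pathfinish p = pathstart p \<and>
      (\<forall>f. f holomorphic_on S \<longrightarrow> contour_integral p f = contour_integral (\<gamma> j) f)" if "j \<in> J" for j
    using polynomial_loop_nearby[OF S \<gamma>, of j] that by metis
  then obtain p where p: "\<And>j. j \<in> J \<Longrightarrow> polynomial_function (p j)"
    "\<And>j. j \<in> J \<Longrightarrow> path_image (p j) \<subseteq> S" "\<And>j. j \<in> J \<Longrightarrow> pathfinish (p j) = pathstart (p j)"
    "\<And>j f. j \<in> J \<Longrightarrow> f holomorphic_on S \<Longrightarrow> contour_integral (p j) f = contour_integral (\<gamma> j) f"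
    by metis
  \<comment> \<open>At a point outside \<open>S\<close> the winding number is itself the integral of
    a function holomorphic on \<open>S\<close>, so the polynomial loops inherit it.\<close>
  have wn: "winding_number (p j) z = winding_number (\<gamma> j) z" if j: "j \<in> J" and z: "z \<notin> S" for j z
  proof -
    have "(\<lambda>w. 1 / (w - z)) holomorphic_on S" using z by (intro holomorphic_intros) auto
    from p(4)[OF j this] show ?thesis
      using j z p(1,2)[OF j] \<gamma>(1,2)[OF j]
      by (subst (1 2) winding_number_valid_path) (auto simp: valid_path_polynomial_function)
  qed
  have "(\<Sum>j\<in>J. c j * contour_integral (p j) (\<lambda>w. f w * (w - a) / (w - a))) = 0"
    using Cauchy_type_integral_cycle_zero[OF S _ J p(1-3), where f = "\<lambda>w. f w * (w - a)" and c = c and z = a] a f zero wn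
    by (simp add: holomorphic_intros)
  moreover have "contour_integral (p j) (\<lambda>w. f w * (w - a) / (w - a)) = contour_integral (\<gamma> j) f"
    if j: "j \<in> J" for j
  proof -
    have "contour_integral (p j) (\<lambda>w. f w * (w - a) / (w - a)) = contour_integral (p j) f"
      using p(2)[OF j] a by (intro contour_integral_cong) auto
    with p(4)[OF j f] show ?thesis by simp
  qed
  ultimately show ?thesis by simp
qed

section \<open>Holomorphic functions with values in a complexified Banach space\<close>

text \<open>In the complexification of a real vector space, \<open>(x, y)\<close> stands for \<open>x + \<i>y\<close>.\<close>

definition cscale :: "complex \<Rightarrow> 'e::real_vector \<times> 'e \<Rightarrow> 'e \<times> 'e" where
  "cscale c p = (Re c *\<^sub>R fst p - Im c *\<^sub>R snd p, Re c *\<^sub>R snd p + Im c *\<^sub>R fst p)"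

definition complexify :: "('e \<Rightarrow> real) \<Rightarrow> 'e \<times> 'e \<Rightarrow> complex" where
  "complexify \<phi> p = Complex (\<phi> (fst p)) (\<phi> (snd p))"

lemma bounded_bilinear_cscale:
  "bounded_bilinear (cscale :: complex \<Rightarrow> 'e::real_normed_vector \<times> 'e \<Rightarrow> _)"
proof
  fix c d :: complex and p q :: "'e \<times> 'e" and r :: real
  show "cscale (c + d) p = cscale c p + cscale d p"
    "cscale c (p + q) = cscale c p + cscale c q"
    "cscale (r *\<^sub>R c) p = r *\<^sub>R cscale c p" "cscale c (r *\<^sub>R p) = r *\<^sub>R cscale c p"
    by (auto simp: cscale_def algebra_simps)
  have "norm (cscale c p) \<le> norm c * norm p * 4" for c and p :: "'e \<times> 'e"
  proof -
    have "norm (cscale c p) \<le> norm (fst (cscale c p)) + norm (snd (cscale c p))"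
      by (metis norm_Pair_le prod.collapse)
    also have "\<dots> \<le> (\<bar>Re c\<bar> * norm (fst p) + \<bar>Im c\<bar> * norm (snd p))
        + (\<bar>Re c\<bar> * norm (snd p) + \<bar>Im c\<bar> * norm (fst p))"
      unfolding cscale_def fst_conv snd_conv
      by (intro add_mono norm_triangle_le norm_triangle_le_diff) auto
    also have "\<dots> \<le> (norm c * norm p + norm c * norm p) + (norm c * norm p + norm c * norm p)"
      using norm_fst_le[of "fst p" "snd p"] norm_snd_le[of "snd p" "fst p"] abs_Re_le_cmod abs_Im_le_cmod
      by (intro add_mono mult_mono) auto
    finally show ?thesis by simp
  qed
  then show "\<exists>K. \<forall>c p. norm (cscale c (p::'e \<times> 'e)) \<le> norm c * norm p * K" by blast
qed

lemma cscale_scaleR_left: "cscale (r *\<^sub>R c) p = r *\<^sub>R cscale c p"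
  by (auto simp: cscale_def algebra_simps)

lemma cscale_cscale: "cscale c (cscale d p) = cscale (c * d) p"
  by (auto simp: cscale_def algebra_simps)

lemma complexify_cscale: "linear \<phi> \<Longrightarrow> complexify \<phi> (cscale c p) = c * complexify \<phi> p"
  by (auto simp: complexify_def cscale_def complex_eq_iff linear_add linear_diff linear_cmul)

lemma bounded_linear_complexify:
  assumes "bounded_linear \<phi>"
  shows "bounded_linear (complexify \<phi>)"
proof -
  have "complexify \<phi> = (\<lambda>p. of_real (\<phi> (fst p)) + \<i> * of_real (\<phi> (snd p)))"
    by (auto simp: complexify_def complex_eq_iff)
  then show ?thesis
    using assms
    by (auto intro!: bounded_linear_add bounded_linear_const_mult
        bounded_linear_compose[OF bounded_linear_of_real]
        bounded_linear_compose[OF _ bounded_linear_fst] bounded_linear_compose[OF _ bounded_linear_snd])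
qed

lemma complexify_eqI:
  fixes p q :: "'e::real_normed_vector \<times> 'e"
  assumes "\<And>\<phi>. bounded_linear \<phi> \<Longrightarrow> complexify \<phi> p = complexify \<phi> q"
  shows "p = q"
proof -
  have "\<phi> (fst p - fst q) = 0 \<and> \<phi> (snd p - snd q) = 0" if "bounded_linear \<phi>" for \<phi> :: "'e \<Rightarrow> real"
    using assms[OF that] that by (simp add: complexify_def bounded_linear.linear linear_diff)
  then have "fst p - fst q = 0" "snd p - snd q = 0"
    by (blast intro: bounded_linear_functional_separates)+
  then show ?thesis by (simp add: prod_eq_iff)
qed

text \<open>Only real functionals are tested: a real functional on \<open>E\<close> extends to a complex one on
  \<open>E \<times> E\<close>.\<close>

definition weakly_holomorphic_on :: "(complex \<Rightarrow> 'e::real_normed_vector \<times> 'e) \<Rightarrow> complex set \<Rightarrow> bool"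
  (infixl "weakly'_holomorphic'_on" 50) where
  "G weakly_holomorphic_on S \<longleftrightarrow> continuous_on S G \<and>
     (\<forall>\<phi>. bounded_linear \<phi> \<longrightarrow> (\<lambda>z. complexify \<phi> (G z)) holomorphic_on S)"

definition cintegral :: "(real \<Rightarrow> complex) \<Rightarrow> (complex \<Rightarrow> 'e::real_normed_vector \<times> 'e) \<Rightarrow> 'e \<times> 'e" where
  "cintegral \<gamma> G = integral {0..1} (\<lambda>t. cscale (vector_derivative \<gamma> (at t within {0..1})) (G (\<gamma> t)))"

lemma weakly_holomorphic_on_subset:
  "G weakly_holomorphic_on S \<Longrightarrow> T \<subseteq> S \<Longrightarrow> G weakly_holomorphic_on T"
  unfolding weakly_holomorphic_on_def using continuous_on_subset holomorphic_on_subset by blast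

lemma complexify_cintegral:
  assumes \<phi>: "bounded_linear \<phi>"
    and "(\<lambda>t. cscale (vector_derivative \<gamma> (at t within {0..1})) (G (\<gamma> t))) integrable_on {0..1}"
  shows "complexify \<phi> (cintegral \<gamma> G) = contour_integral \<gamma> (\<lambda>z. complexify \<phi> (G z))"
proof -
  have "((\<lambda>t. complexify \<phi> (cscale (vector_derivative \<gamma> (at t within {0..1})) (G (\<gamma> t))))
      has_integral complexify \<phi> (cintegral \<gamma> G)) {0..1}"
    using has_integral_linear[OF integrable_integral[OF assms(2)] bounded_linear_complexify[OF \<phi>]]
    by (simp add: cintegral_def o_def)
  then have "((\<lambda>z. complexify \<phi> (G z)) has_contour_integral complexify \<phi> (cintegral \<gamma> G)) \<gamma>"
    using \<phi> by (simp add: has_contour_integral_def complexify_cscale bounded_linear.linear mult.commute)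
  then show ?thesis by (simp add: contour_integral_unique)
qed

text \<open>\<open>H\<close> integrates along the segment from the centre. Its increments can be
  computed after applying a functional, where a scalar primitive exists; separation by functionals
  returns the result to \<open>E\<close>, and continuity of \<open>G\<close> gives the derivative in
  norm.\<close>

lemma cscale_primitive_on_ball:
  fixes G :: "complex \<Rightarrow> 'e::banach \<times> 'e"
  assumes G: "G weakly_holomorphic_on ball a r"
  shows "\<exists>H. \<forall>z\<in>ball a r. (H has_derivative (\<lambda>h. cscale h (G z))) (at z)"
proof (cases "r > 0")
  case True
  interpret cs: bounded_bilinear "cscale :: complex \<Rightarrow> 'e \<times> 'e \<Rightarrow> _" by (rule bounded_bilinear_cscale)
  define H where "H z = cintegral (linepath a z) G" for z
  have Gc: "continuous_on (ball a r) G" using G by (simp add: weakly_holomorphic_on_def)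
  have line: "linepath x y t \<in> ball a r" if "x \<in> ball a r" "y \<in> ball a r" "t \<in> {0..1}" for x y t
    by (metis convex_ball convex_contains_segment linepath_image_01 image_eqI subsetD that)
  have cont: "continuous_on {0..1} (\<lambda>t. G (linepath x y t))" if "x \<in> ball a r" "y \<in> ball a r" for x y
    using line[OF that] by (intro continuous_on_compose2[OF Gc] continuous_on_linepath) auto
  have vd: "cintegral (linepath x y) G = integral {0..1} (\<lambda>t. cscale (y - x) (G (linepath x y t)))"
    for x y :: complex
    unfolding cintegral_def by (rule integral_cong) (simp add: vector_derivative_linepath_within)
  have int: "complexify \<phi> (cintegral (linepath x y) G)
      = contour_integral (linepath x y) (\<lambda>z. complexify \<phi> (G z))"
    if "bounded_linear \<phi>" "x \<in> ball a r" "y \<in> ball a r" for \<phi> x y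
  proof (rule complexify_cintegral[OF that(1)])
    have "(\<lambda>t. cscale (y - x) (G (linepath x y t))) integrable_on {0..1}"
      by (intro integrable_continuous_real cs.continuous_on continuous_on_const cont that)
    then show "(\<lambda>t. cscale (vector_derivative (linepath x y) (at t within {0..1}))
        (G (linepath x y t))) integrable_on {0..1}"
      by (rule integrable_eq) (simp add: vector_derivative_linepath_within)
  qed
  have H: "H y - H x = cintegral (linepath x y) G" if xy: "x \<in> ball a r" "y \<in> ball a r" for x y
  proof (rule complexify_eqI)
    fix \<phi> :: "'e \<Rightarrow> real" assume \<phi>: "bounded_linear \<phi>"
    obtain F where F: "\<And>z. z \<in> ball a r \<Longrightarrow>
        (F has_field_derivative complexify \<phi> (G z)) (at z within ball a r)"
      using holomorphic_convex_primitive'[of "ball a r" "\<lambda>z. complexify \<phi> (G z)"] G \<phi>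
      by (auto simp: weakly_holomorphic_on_def)
    \<comment> \<open>The segment integral is an increment of the scalar primitive \<open>F\<close>;
      subtracting the cases starting at \<open>a\<close> yields the increment of
      \<open>H\<close>.\<close>
    have "complexify \<phi> (cintegral (linepath x y) G) = F y - F x"
      if "x \<in> ball a r" "y \<in> ball a r" for x y
      using contour_integral_primitive[OF F valid_path_linepath, of x y] int[OF \<phi> that]
        line[OF that] by (simp add: contour_integral_unique path_image_def image_subset_iff)
    with xy True show "complexify \<phi> (H y - H x) = complexify \<phi> (cintegral (linepath x y) G)"
      using bounded_linear_complexify[OF \<phi>] by (simp add: H_def bounded_linear.linear linear_diff)
  qed
  have "(H has_derivative (\<lambda>h. cscale h (G x))) (at x)" if x: "x \<in> ball a r" for x
    unfolding has_derivative_at_alt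
  proof (intro conjI allI impI)
    show "bounded_linear (\<lambda>h. cscale h (G x))" by (rule cs.bounded_linear_left)
    fix e :: real assume e: "e > 0"
    obtain K where K: "K > 0" "\<And>c p. norm (cscale c (p::'e \<times> 'e)) \<le> norm c * norm p * K"
      using cs.pos_bounded by blast
    obtain d where d: "d > 0" "\<And>y. y \<in> ball a r \<Longrightarrow> dist y x < d \<Longrightarrow> dist (G y) (G x) < e / K"
      using Gc x e K(1) unfolding continuous_on_iff by (metis divide_pos_pos)
    obtain s where s: "s > 0" "ball x s \<subseteq> ball a r"
      using x open_ball open_contains_ball by metis
    have "norm (H y - H x - cscale (y - x) (G x)) \<le> e * norm (y - x)"
      if y: "norm (y - x) < min d s" for y
    proof -
      have yb: "y \<in> ball a r" using y s by (auto simp: dist_norm norm_minus_commute)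
      have "cscale (y - x) (G x) = integral {0..1} (\<lambda>t::real. cscale (y - x) (G x))" by simp
      then have "H y - H x - cscale (y - x) (G x)
          = integral {0..1} (\<lambda>t. cscale (y - x) (G (linepath x y t))) -
            integral {0..1} (\<lambda>t::real. cscale (y - x) (G x))"
        using H[OF x yb] by (simp only: vd)
      also have "\<dots> = integral {0..1} (\<lambda>t. cscale (y - x) (G (linepath x y t)) - cscale (y - x) (G x))"
        by (intro integral_diff[symmetric] integrable_continuous_real cs.continuous_on
            continuous_on_const cont x yb)
      also have "norm \<dots> \<le> (e * norm (y - x)) * (1 - 0)"
      proof (rule integral_bound)
        fix t :: real assume t: "t \<in> {0..1}"
        have "norm (linepath x y t - x) = t * norm (y - x)"
          using t by (simp add: linepath_def algebra_simps flip: scaleR_diff_right)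
        also have "\<dots> \<le> norm (y - x)" using t by (simp add: mult_left_le_one_le)
        finally have "dist (linepath x y t) x < d" using y by (simp add: dist_norm)
        then have "norm (G (linepath x y t) - G x) \<le> e / K"
          using d(2)[OF line[OF x yb t]] by (simp add: dist_norm)
        moreover have "norm (cscale (y - x) (G (linepath x y t)) - cscale (y - x) (G x))
            \<le> norm (y - x) * norm (G (linepath x y t) - G x) * K"
          using K(2) by (simp flip: cs.diff_right)
        moreover have "norm (y - x) * norm (G (linepath x y t) - G x) * K \<le> norm (y - x) * (e / K) * K"
          using calculation(1) K(1) by (intro mult_right_mono mult_left_mono) auto
        ultimately show "norm (cscale (y - x) (G (linepath x y t)) - cscale (y - x) (G x))
            \<le> e * norm (y - x)" using K(1) by (simp add: mult.commute)
      qed (auto intro!: continuous_intros cs.continuous_on cont x yb)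
      finally show ?thesis by simp
    qed
    then show "\<exists>d>0. \<forall>y. norm (y - x) < d \<longrightarrow> norm (H y - H x - cscale (y - x) (G x)) \<le> e * norm (y - x)"
      using d(1) s(1) by (intro exI[of _ "min d s"]) auto
  qed
  then show ?thesis by blast
qed (simp add: ball_empty)

text \<open>The derivative of a valid path may be unbounded at the break points, so continuity of the
  integrand would not suffice; local primitives are needed.\<close>

lemma cintegrable:
  fixes G :: "complex \<Rightarrow> 'e::banach \<times> 'e"
  assumes S: "open S" and G: "G weakly_holomorphic_on S"
    and \<gamma>: "valid_path \<gamma>" "path_image \<gamma> \<subseteq> S"
  shows "(\<lambda>t. cscale (vector_derivative \<gamma> (at t within {0..1})) (G (\<gamma> t))) integrable_on {0..1}"
proof -
  let ?f = "\<lambda>t. cscale (vector_derivative \<gamma> (at t within {0..1})) (G (\<gamma> t))"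
  obtain N where N: "finite N" "\<And>t. t \<in> {0..1} - N \<Longrightarrow> \<gamma> differentiable at t"
    and \<gamma>c: "continuous_on {0..1} \<gamma>"
    using \<gamma>(1) unfolding valid_path_def piecewise_C1_differentiable_on_def C1_differentiable_on_eq
    by blast
  \<comment> \<open>By compactness it is enough to integrate over short intervals whose image stays
    in one ball inside \<open>S\<close>.\<close>
  have "?f integrable_on cbox 0 1"
  proof (rule integrable_on_little_subintervals, rule ballI)
    fix t :: real assume t: "t \<in> cbox 0 1"
    then have "\<gamma> t \<in> S" using \<gamma>(2) by (auto simp: path_image_def)
    then obtain r where r: "r > 0" "ball (\<gamma> t) r \<subseteq> S" using S open_contains_ball by metis
    obtain H where H: "\<And>z. z \<in> ball (\<gamma> t) r \<Longrightarrow> (H has_derivative (\<lambda>h. cscale h (G z))) (at z)"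
      using cscale_primitive_on_ball[OF weakly_holomorphic_on_subset[OF G r(2)]] by blast
    obtain d where d: "d > 0" "\<And>s. s \<in> {0..1} \<Longrightarrow> dist s t < d \<Longrightarrow> \<gamma> s \<in> ball (\<gamma> t) r"
      using \<gamma>c t r(1) unfolding continuous_on_iff mem_ball by (metis box_real(2) dist_commute)
    have "?f integrable_on cbox u v"
      if uv: "t \<in> cbox u v" "cbox u v \<subseteq> ball t d" "cbox u v \<subseteq> cbox 0 1" for u v
    proof -
      have inb: "\<gamma> s \<in> ball (\<gamma> t) r" if "s \<in> {u..v}" for s
        using that uv d(2)[of s] by (auto simp: subset_eq dist_commute)
      \<comment> \<open>The fundamental theorem tolerates the finite set \<open>N\<close> of break
        points because the primitive along the path is continuous there too.\<close>
      have "(?f has_integral (H (\<gamma> v) - H (\<gamma> u))) {u..v}"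
      proof (rule fundamental_theorem_of_calculus_interior_strong[OF N(1)])
        show "u \<le> v" using uv(1) by auto
        show "continuous_on {u..v} (\<lambda>s. H (\<gamma> s))"
          using uv(3) inb
          by (intro continuous_on_compose2[of "ball (\<gamma> t) r" H _ \<gamma>] continuous_on_subset[OF \<gamma>c])
            (auto intro!: has_derivative_continuous_on has_derivative_at_withinI[OF H])
        fix s assume s: "s \<in> {u<..<v} - N"
        then have s01: "s \<in> {0<..<1}" using uv(3) by auto
        have "(\<gamma> has_vector_derivative vector_derivative \<gamma> (at s)) (at s)"
          using N(2)[of s] s s01 by (simp add: vector_derivative_works)
        moreover have "at s within {0..1} = at s"
          using s01 by (intro at_within_interior) auto
        ultimately have "(\<gamma> has_derivative (\<lambda>x. x *\<^sub>R vector_derivative \<gamma> (at s within {0..1}))) (at s)"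
          by (simp add: has_vector_derivative_def)
        from diff_chain_at[OF this H[OF inb]] s
        show "((\<lambda>s. H (\<gamma> s)) has_vector_derivative ?f s) (at s)"
          by (simp add: has_vector_derivative_def o_def cscale_scaleR_left)
      qed
      then show ?thesis by (auto simp: integrable_on_def)
    qed
    with d(1) show "\<exists>d>0. \<forall>u v. t \<in> cbox u v \<and> cbox u v \<subseteq> ball t d \<and> cbox u v \<subseteq> cbox 0 1 \<longrightarrow>
        ?f integrable_on cbox u v" by blast
  qed
  then show ?thesis by simp
qed

section \<open>Homologous cycles and intrinsic integrands\<close>

definition cycle_in :: "complex set \<Rightarrow> (complex \<Rightarrow> complex) \<Rightarrow> (real \<Rightarrow> complex) set \<Rightarrow> bool" where
  "cycle_in S \<eta> \<Gamma> \<longleftrightarrow> finite \<Gamma> \<and>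
     (\<forall>\<gamma>\<in>\<Gamma>. valid_path \<gamma> \<and> path_image \<gamma> \<subseteq> S \<and> pathfinish \<gamma> = pathstart \<gamma>) \<and>
     (\<forall>z. z \<notin> S \<longrightarrow> (\<Sum>\<gamma>\<in>\<Gamma>. winding_number \<gamma> z) = \<eta> z)"

text \<open>Two cycles with the same winding numbers \<eta> off \<open>S\<close> have a difference
  that winds around no point outside \<open>S\<close>. The disjoint sum as index set carries the
  signs and lets a path occur in both cycles.\<close>

lemma contour_integral_homologous:
  assumes S: "open S" and f: "f holomorphic_on S" and \<Gamma>: "cycle_in S \<eta> \<Gamma>" and \<Delta>: "cycle_in S \<eta> \<Delta>"
  shows "(\<Sum>\<gamma>\<in>\<Gamma>. contour_integral \<gamma> f) = (\<Sum>\<gamma>\<in>\<Delta>. contour_integral \<gamma> f)"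
proof -
  define c :: "(real \<Rightarrow> complex) + (real \<Rightarrow> complex) \<Rightarrow> complex" where
    "c = case_sum (\<lambda>_. 1) (\<lambda>_. - 1)"
  define g :: "(real \<Rightarrow> complex) + (real \<Rightarrow> complex) \<Rightarrow> real \<Rightarrow> complex" where
    "g = case_sum (\<lambda>\<gamma>. \<gamma>) (\<lambda>\<gamma>. \<gamma>)"
  have fin: "finite \<Gamma>" "finite \<Delta>" using \<Gamma> \<Delta> by (auto simp: cycle_in_def)
  have sum: "(\<Sum>j\<in>\<Gamma> <+> \<Delta>. c j * X (g j)) = (\<Sum>\<gamma>\<in>\<Gamma>. X \<gamma>) - (\<Sum>\<gamma>\<in>\<Delta>. X \<gamma>)" for X :: "_ \<Rightarrow> complex"
    using fin by (simp add: sum.Plus c_def g_def sum_negf)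
  have "(\<Sum>j\<in>\<Gamma> <+> \<Delta>. c j * contour_integral (g j) f) = 0"
  proof (rule Cauchy_theorem_cycle[OF S f])
    show "finite (\<Gamma> <+> \<Delta>)" using fin by simp
    show "(\<Sum>j\<in>\<Gamma> <+> \<Delta>. c j * winding_number (g j) z) = 0" if "z \<notin> S" for z
      using that \<Gamma> \<Delta> by (simp add: sum[of "\<lambda>\<gamma>. winding_number \<gamma> z"] cycle_in_def)
  qed (use \<Gamma> \<Delta> in \<open>auto simp: cycle_in_def g_def\<close>)
  then show ?thesis by (simp add: sum[of "\<lambda>\<gamma>. contour_integral \<gamma> f"])
qed

lemma complexify_cintegral_cycle:
  fixes G :: "complex \<Rightarrow> 'e::banach \<times> 'e"
  assumes S: "open S" and G: "G weakly_holomorphic_on S" and \<Gamma>: "cycle_in S \<eta> \<Gamma>"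
    and \<phi>: "bounded_linear \<phi>"
  shows "complexify \<phi> (\<Sum>\<gamma>\<in>\<Gamma>. cintegral \<gamma> G) = (\<Sum>\<gamma>\<in>\<Gamma>. contour_integral \<gamma> (\<lambda>z. complexify \<phi> (G z)))"
proof -
  have "complexify \<phi> (cintegral \<gamma> G) = contour_integral \<gamma> (\<lambda>z. complexify \<phi> (G z))" if "\<gamma> \<in> \<Gamma>" for \<gamma>
    using that \<Gamma> by (intro complexify_cintegral \<phi> cintegrable[OF S G]) (auto simp: cycle_in_def)
  then show ?thesis
    using bounded_linear_complexify[OF \<phi>] by (simp add: bounded_linear.linear linear_sum)
qed

theorem cintegral_homologous:
  fixes G :: "complex \<Rightarrow> 'e::banach \<times> 'e"
  assumes S: "open S" and G: "G weakly_holomorphic_on S"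
    and \<Gamma>: "cycle_in S \<eta> \<Gamma>" and \<Delta>: "cycle_in S \<eta> \<Delta>"
  shows "(\<Sum>\<gamma>\<in>\<Gamma>. cintegral \<gamma> G) = (\<Sum>\<gamma>\<in>\<Delta>. cintegral \<gamma> G)"
proof (rule complexify_eqI)
  fix \<phi> :: "'e \<Rightarrow> real" assume \<phi>: "bounded_linear \<phi>"
  with contour_integral_homologous[OF S _ \<Gamma> \<Delta>] G
  show "complexify \<phi> (\<Sum>\<gamma>\<in>\<Gamma>. cintegral \<gamma> G) = complexify \<phi> (\<Sum>\<gamma>\<in>\<Delta>. cintegral \<gamma> G)"
    by (simp add: weakly_holomorphic_on_def complexify_cintegral_cycle[OF S G \<Gamma> \<phi>]
        complexify_cintegral_cycle[OF S G \<Delta> \<phi>])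
qed

text \<open>Conjugation reverses the orientation of a cycle that is symmetric up to homology, so the
  integral of an intrinsic function is purely imaginary.\<close>

lemma contour_integral_intrinsic:
  assumes S: "open S" "cnj ` S = S" and f: "f holomorphic_on S"
    and fc: "\<And>z. z \<in> S \<Longrightarrow> f (cnj z) = cnj (f z)"
    and \<Gamma>: "cycle_in S \<eta> \<Gamma>" and \<eta>: "\<And>z. z \<notin> S \<Longrightarrow> \<eta> (cnj z) = cnj (\<eta> z)"
  shows "Re (\<Sum>\<gamma>\<in>\<Gamma>. contour_integral \<gamma> f) = 0"
proof -
  define g :: "bool \<times> (real \<Rightarrow> complex) \<Rightarrow> real \<Rightarrow> complex" where
    "g j = (if fst j then snd j else cnj \<circ> snd j)" for j
  have fin: "finite \<Gamma>" using \<Gamma> by (simp add: cycle_in_def)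
  have cS: "cnj z \<in> S \<longleftrightarrow> z \<in> S" for z using S(2) by (metis complex_cnj_cnj image_eqI imageE)
  have sum: "(\<Sum>j\<in>UNIV \<times> \<Gamma>. 1 * X (g j)) = (\<Sum>\<gamma>\<in>\<Gamma>. X \<gamma>) + (\<Sum>\<gamma>\<in>\<Gamma>. X (cnj \<circ> \<gamma>))"
    for X :: "_ \<Rightarrow> complex"
    by (simp add: sum.cartesian_product' UNIV_bool g_def add.commute)
  have wn: "winding_number (cnj \<circ> \<gamma>) z = - cnj (winding_number \<gamma> (cnj z))" if "\<gamma> \<in> \<Gamma>" "z \<notin> S" for \<gamma> z
    using that \<Gamma> cS[of z] winding_number_cnj[of \<gamma> "cnj z"]
    by (auto simp: cycle_in_def valid_path_imp_path)
  have "(\<Sum>j\<in>UNIV \<times> \<Gamma>. 1 * contour_integral (g j) f) = 0"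
  proof (rule Cauchy_theorem_cycle[OF S(1) f])
    show "finite ((UNIV :: bool set) \<times> \<Gamma>)" using fin by simp
    fix j :: "bool \<times> (real \<Rightarrow> complex)" assume j: "j \<in> UNIV \<times> \<Gamma>"
    then have \<gamma>: "valid_path (snd j)" "path_image (snd j) \<subseteq> S" "pathfinish (snd j) = pathstart (snd j)"
      using \<Gamma> by (auto simp: cycle_in_def)
    have "path_image (cnj \<circ> snd j) \<subseteq> S" using \<gamma>(2) cS by (auto simp: path_image_def)
    then show "path_image (g j) \<subseteq> S" using \<gamma>(2) by (simp add: g_def)
    show "valid_path (g j)" using \<gamma>(1) by (simp add: g_def valid_path_cnj)
    show "pathfinish (g j) = pathstart (g j)"
      using \<gamma>(3) by (simp add: g_def pathfinish_def pathstart_def)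
  next
    fix z assume z: "z \<notin> S"
    then have "(\<Sum>\<gamma>\<in>\<Gamma>. winding_number \<gamma> z) = \<eta> z" "(\<Sum>\<gamma>\<in>\<Gamma>. winding_number \<gamma> (cnj z)) = \<eta> (cnj z)"
      using \<Gamma> cS[of z] by (auto simp: cycle_in_def)
    moreover have "(\<Sum>\<gamma>\<in>\<Gamma>. winding_number (cnj \<circ> \<gamma>) z) = - cnj (\<Sum>\<gamma>\<in>\<Gamma>. winding_number \<gamma> (cnj z))"
      using z by (simp add: wn sum_negf)
    ultimately show "(\<Sum>j\<in>UNIV \<times> \<Gamma>. 1 * winding_number (g j) z) = 0"
      using \<eta>[OF z] sum[of "\<lambda>\<gamma>. winding_number \<gamma> z"] by simp
  qed
  moreover have "contour_integral (cnj \<circ> \<gamma>) f = cnj (contour_integral \<gamma> f)" if "\<gamma> \<in> \<Gamma>" for \<gamma>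
  proof -
    have v: "valid_path \<gamma>" "path_image \<gamma> \<subseteq> S" using \<Gamma> that by (auto simp: cycle_in_def)
    \<comment> \<open>An intrinsic \<open>f\<close> equals \<open>cnj \<circ> f \<circ> cnj\<close>
      on the path, so the mirrored path contributes the conjugate integral, and the two together
      give twice the real part.\<close>
    have "contour_integral \<gamma> (cnj \<circ> f \<circ> cnj) = contour_integral \<gamma> f"
      using v(2) fc by (intro contour_integral_cong) auto
    then show ?thesis using contour_integral_cnj[OF v(1)] by simp
  qed
  ultimately have "(\<Sum>\<gamma>\<in>\<Gamma>. contour_integral \<gamma> f) + cnj (\<Sum>\<gamma>\<in>\<Gamma>. contour_integral \<gamma> f) = 0"
    using sum[of "\<lambda>\<gamma>. contour_integral \<gamma> f"] by simp
  from arg_cong[OF this, of Re] show ?thesis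
    unfolding plus_complex.simps complex_cnj by simp
qed

theorem cintegral_intrinsic:
  fixes G :: "complex \<Rightarrow> 'e::banach \<times> 'e"
  assumes S: "open S" "cnj ` S = S" and G: "G weakly_holomorphic_on S"
    and Gc: "\<And>z. z \<in> S \<Longrightarrow> G (cnj z) = (fst (G z), - snd (G z))"
    and \<Gamma>: "cycle_in S \<eta> \<Gamma>" and \<eta>: "\<And>z. z \<notin> S \<Longrightarrow> \<eta> (cnj z) = cnj (\<eta> z)"
  shows "fst (\<Sum>\<gamma>\<in>\<Gamma>. cintegral \<gamma> G) = 0"
proof (rule bounded_linear_functional_separates)
  fix \<phi> :: "'e \<Rightarrow> real" assume \<phi>: "bounded_linear \<phi>"
  note complexify_cintegral_cycle[OF S(1) G \<Gamma> \<phi>]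
  moreover have "complexify \<phi> (G (cnj z)) = cnj (complexify \<phi> (G z))" if "z \<in> S" for z
    using Gc[OF that] \<phi> by (simp add: complexify_def bounded_linear.linear linear_neg complex_eq_iff)
  ultimately have "Re (complexify \<phi> (\<Sum>\<gamma>\<in>\<Gamma>. cintegral \<gamma> G)) = 0"
    using contour_integral_intrinsic[OF S _ _ \<Gamma> \<eta>, of "\<lambda>z. complexify \<phi> (G z)"] G \<phi>
    by (simp add: weakly_holomorphic_on_def)
  then show "\<phi> (fst (\<Sum>\<gamma>\<in>\<Gamma>. cintegral \<gamma> G)) = 0" by (simp add: complexify_def)
qed

section \<open>Resolvents in the complexification of an operator algebra\<close>

definition pmul :: "('v::real_normed_vector \<Rightarrow>\<^sub>L 'v) \<times> ('v \<Rightarrow>\<^sub>L 'v) \<Rightarrow> ('v \<Rightarrow>\<^sub>L 'v) \<times> ('v \<Rightarrow>\<^sub>L 'v) \<Rightarrow>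
    ('v \<Rightarrow>\<^sub>L 'v) \<times> ('v \<Rightarrow>\<^sub>L 'v)" where
  "pmul X Y = ((fst X o\<^sub>L fst Y) - (snd X o\<^sub>L snd Y), (fst X o\<^sub>L snd Y) + (snd X o\<^sub>L fst Y))"

definition pone :: "('v::real_normed_vector \<Rightarrow>\<^sub>L 'v) \<times> ('v \<Rightarrow>\<^sub>L 'v)" where
  "pone = (id_blinfun, 0)"

definition pconj :: "'e::uminus \<times> 'e \<Rightarrow> 'e \<times> 'e" where
  "pconj X = (fst X, - snd X)"

definition ppow :: "('v::real_normed_vector \<Rightarrow>\<^sub>L 'v) \<times> ('v \<Rightarrow>\<^sub>L 'v) \<Rightarrow> nat \<Rightarrow> ('v \<Rightarrow>\<^sub>L 'v) \<times> ('v \<Rightarrow>\<^sub>L 'v)" where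
  "ppow X l = (pmul X ^^ l) pone"

lemmas blinfun_compose_simps =
  bounded_bilinear.add_left[OF bounded_bilinear_blinfun_compose]
  bounded_bilinear.add_right[OF bounded_bilinear_blinfun_compose]
  bounded_bilinear.diff_left[OF bounded_bilinear_blinfun_compose]
  bounded_bilinear.diff_right[OF bounded_bilinear_blinfun_compose]
  bounded_bilinear.minus_left[OF bounded_bilinear_blinfun_compose]
  bounded_bilinear.minus_right[OF bounded_bilinear_blinfun_compose]
  bounded_bilinear.scaleR_left[OF bounded_bilinear_blinfun_compose]
  bounded_bilinear.scaleR_right[OF bounded_bilinear_blinfun_compose]
  bounded_bilinear.zero_left[OF bounded_bilinear_blinfun_compose]
  bounded_bilinear.zero_right[OF bounded_bilinear_blinfun_compose]

lemma blinfun_compose_assoc: "(X o\<^sub>L Y) o\<^sub>L Z = X o\<^sub>L (Y o\<^sub>L Z)"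
  by (auto intro: blinfun_eqI)

lemma id_blinfun_compose [simp]: "id_blinfun o\<^sub>L X = X" "X o\<^sub>L id_blinfun = X"
  by (auto intro: blinfun_eqI)

lemma bounded_bilinear_pmul:
  "bounded_bilinear (pmul :: ('v::real_normed_vector \<Rightarrow>\<^sub>L 'v) \<times> ('v \<Rightarrow>\<^sub>L 'v) \<Rightarrow> _)"
proof
  fix X X' Y Y' :: "('v \<Rightarrow>\<^sub>L 'v) \<times> ('v \<Rightarrow>\<^sub>L 'v)" and r :: real
  show "pmul (X + X') Y = pmul X Y + pmul X' Y" "pmul X (Y + Y') = pmul X Y + pmul X Y'"
    "pmul (r *\<^sub>R X) Y = r *\<^sub>R pmul X Y" "pmul X (r *\<^sub>R Y) = r *\<^sub>R pmul X Y"
    by (auto simp: pmul_def blinfun_compose_simps algebra_simps)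
  have "norm (pmul X Y) \<le> norm X * norm Y * 4" for X Y :: "('v \<Rightarrow>\<^sub>L 'v) \<times> ('v \<Rightarrow>\<^sub>L 'v)"
  proof -
    have "norm (pmul X Y) \<le> norm (fst (pmul X Y)) + norm (snd (pmul X Y))"
      by (metis norm_Pair_le prod.collapse)
    also have "\<dots> \<le> (norm (fst X) * norm (fst Y) + norm (snd X) * norm (snd Y))
        + (norm (fst X) * norm (snd Y) + norm (snd X) * norm (fst Y))"
      unfolding pmul_def fst_conv snd_conv
      by (intro add_mono norm_triangle_le norm_triangle_le_diff norm_blinfun_compose)
    also have "\<dots> \<le> (norm X * norm Y + norm X * norm Y) + (norm X * norm Y + norm X * norm Y)"
      using norm_fst_le[of "fst X" "snd X"] norm_snd_le[of "snd X" "fst X"]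
        norm_fst_le[of "fst Y" "snd Y"] norm_snd_le[of "snd Y" "fst Y"]
      by (intro add_mono mult_mono) auto
    finally show ?thesis by simp
  qed
  then show "\<exists>K. \<forall>X Y. norm (pmul X (Y :: ('v \<Rightarrow>\<^sub>L 'v) \<times> ('v \<Rightarrow>\<^sub>L 'v))) \<le> norm X * norm Y * K" by blast
qed

interpretation pmul: bounded_bilinear pmul by (rule bounded_bilinear_pmul)
interpretation cscale: bounded_bilinear cscale by (rule bounded_bilinear_cscale)

lemma pmul_assoc: "pmul (pmul X Y) Z = pmul X (pmul Y Z)"
  by (simp add: pmul_def blinfun_compose_simps blinfun_compose_assoc algebra_simps)

lemma pmul_one [simp]: "pmul pone X = X" "pmul X pone = X"
  by (simp_all add: pmul_def pone_def blinfun_compose_simps)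

lemma pmul_cscale: "pmul (cscale c X) Y = cscale c (pmul X Y)" "pmul X (cscale c Y) = cscale c (pmul X Y)"
  by (simp_all add: pmul_def cscale_def blinfun_compose_simps algebra_simps)

lemma pconj_pmul: "pconj (pmul X Y) = pmul (pconj X) (pconj Y)"
  by (simp add: pmul_def pconj_def blinfun_compose_simps)

lemma pconj_pone [simp]: "pconj pone = pone" by (simp add: pone_def pconj_def)

lemma pconj_cscale: "pconj (cscale c X) = cscale (cnj c) (pconj X)"
  by (simp add: pconj_def cscale_def)

lemma pconj_ppow: "pconj (ppow X l) = ppow (pconj X) l"
  by (induction l) (simp_all add: ppow_def pconj_pmul)

lemma ppow_simps: "ppow X 0 = pone" "ppow X (Suc l) = pmul X (ppow X l)"
  by (simp_all add: ppow_def)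

text \<open>\<open>pshift B w\<close> is \<open>w + B\<close>, not \<open>w - B\<close>, so \<open>presolvent_set B\<close> is the resolvent set of \<open>-B\<close>.\<close>

definition pshift :: "('v::real_normed_vector \<Rightarrow>\<^sub>L 'v) \<Rightarrow> complex \<Rightarrow> ('v \<Rightarrow>\<^sub>L 'v) \<times> ('v \<Rightarrow>\<^sub>L 'v)" where
  "pshift B w = cscale w pone + (B, 0)"

definition presolves :: "('v::real_normed_vector \<Rightarrow>\<^sub>L 'v) \<Rightarrow> complex \<Rightarrow> ('v \<Rightarrow>\<^sub>L 'v) \<times> ('v \<Rightarrow>\<^sub>L 'v) \<Rightarrow> bool" where
  "presolves B w X \<longleftrightarrow> pmul (pshift B w) X = pone \<and> pmul X (pshift B w) = pone"

definition presolvent_set :: "('v::real_normed_vector \<Rightarrow>\<^sub>L 'v) \<Rightarrow> complex set" where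
  "presolvent_set B = {w. \<exists>X. presolves B w X}"

definition presolvent :: "('v::real_normed_vector \<Rightarrow>\<^sub>L 'v) \<Rightarrow> complex \<Rightarrow> ('v \<Rightarrow>\<^sub>L 'v) \<times> ('v \<Rightarrow>\<^sub>L 'v)" where
  "presolvent B w = (THE X. presolves B w X)"

lemma presolves_unique: "presolves B w X \<Longrightarrow> presolves B w Y \<Longrightarrow> X = Y"
  unfolding presolves_def by (metis pmul_assoc pmul_one)

lemma presolvent_eq: "presolves B w X \<Longrightarrow> presolvent B w = X"
  unfolding presolvent_def by (blast intro: the_equality presolves_unique)

lemma presolves_presolvent: "w \<in> presolvent_set B \<Longrightarrow> presolves B w (presolvent B w)"
  unfolding presolvent_set_def presolvent_def mem_Collect_eq
  by (rule theI') (blast intro: presolves_unique)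

lemma pshift_diff: "pshift B w = pshift B v + cscale (w - v) pone"
  by (simp add: pshift_def cscale.diff_left)

lemma pconj_pshift: "pconj (pshift B w) = pshift B (cnj w)"
  by (simp add: pshift_def pconj_def cscale_def pone_def)

lemma presolves_cnj: "presolves B w X \<Longrightarrow> presolves B (cnj w) (pconj X)"
  unfolding presolves_def by (simp flip: pconj_pshift pconj_pmul)

lemma presolvent_cnj:
  assumes "w \<in> presolvent_set B"
  shows "cnj w \<in> presolvent_set B" "presolvent B (cnj w) = pconj (presolvent B w)"
proof -
  note p = presolves_cnj[OF presolves_presolvent[OF assms]]
  from p show "cnj w \<in> presolvent_set B" unfolding presolvent_set_def by blast
  from p show "presolvent B (cnj w) = pconj (presolvent B w)" by (rule presolvent_eq)
qed

text \<open>The minus sign belongs to the resolvent of \<open>w + B\<close>. With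
  \<open>w - v\<close> factored out, the cofactor is the difference quotient of the resolvent,
  defined also at \<open>w = v\<close>.\<close>

lemma presolvent_identity:
  assumes "w \<in> presolvent_set B" "v \<in> presolvent_set B"
  shows "presolvent B w - presolvent B v
    = cscale (w - v) (- pmul (presolvent B w) (presolvent B v))"
proof -
  let ?R = "presolvent B w" and ?S = "presolvent B v"
  have R: "pmul ?R (pshift B w) = pone" and S: "pmul (pshift B v) ?S = pone"
    using presolves_presolvent assms by (auto simp: presolves_def)
  have "pone = pmul ?R (pshift B v) + cscale (w - v) ?R"
    using R by (simp add: pshift_diff[of B w v] pmul.add_right pmul_cscale)
  then have "?S = pmul (pmul ?R (pshift B v) + cscale (w - v) ?R) ?S" by (metis pmul_one(1))
  also have "\<dots> = ?R + cscale (w - v) (pmul ?R ?S)"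
    by (simp add: pmul.add_left pmul_assoc S pmul_cscale)
  finally have "?S = ?R + cscale (w - v) (pmul ?R ?S)" .
  then show ?thesis by (simp add: cscale.minus_right algebra_simps)
qed

text \<open>Writing \<open>w + B\<close> as \<open>(v + B) + (w - v)\<close> turns invertibility
  into a fixed-point equation with contraction constant 1/2. One equation gives a right inverse, its
  mirror image a left inverse, and associativity identifies them; the equation also yields the norm
  bound.\<close>

lemma presolvent_near:
  fixes B :: "'v::banach \<Rightarrow>\<^sub>L 'v"
  assumes v: "v \<in> presolvent_set B"
  shows "\<exists>d>0. \<forall>w. dist w v < d \<longrightarrow> w \<in> presolvent_set B
    \<and> norm (presolvent B w) \<le> 2 * norm (presolvent B v)"
proof -
  let ?R = "presolvent B v"
  have R: "pmul ?R (pshift B v) = pone" "pmul (pshift B v) ?R = pone"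
    using presolves_presolvent v by (auto simp: presolves_def)
  obtain K where K: "K > 0" "\<And>X Y::('v \<Rightarrow>\<^sub>L 'v) \<times> ('v \<Rightarrow>\<^sub>L 'v). norm (pmul X Y) \<le> norm X * norm Y * K"
    using pmul.pos_bounded by blast
  obtain L where L: "L > 0" "\<And>c. \<And>X::('v \<Rightarrow>\<^sub>L 'v) \<times> ('v \<Rightarrow>\<^sub>L 'v). norm (cscale c X) \<le> norm c * norm X * L"
    using cscale.pos_bounded by blast
  \<comment> \<open>\<open>K\<close> and \<open>L\<close> are the constants of the two bilinear maps
    for the norm on pairs. The choice makes \<open>d * (norm ?R * K * L)\<close> at most 1/2, and
    the \<open>+ 1\<close> keeps the denominator positive.\<close>
  define d where "d = 1 / (2 * (norm ?R * K * L + 1))"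
  have "norm ?R * K * L \<ge> 0" using K L by simp
  then have d: "d > 0" "d * (norm ?R * K * L) \<le> 1 / 2" by (simp_all add: d_def field_simps)
  have "w \<in> presolvent_set B \<and> norm (presolvent B w) \<le> 2 * norm ?R" if w: "dist w v < d" for w
  proof -
    have half: "norm (cscale (w - v) Z) \<le> 1 / 2 * norm X" if "norm Z \<le> norm ?R * norm X * K"
      for X Z :: "('v \<Rightarrow>\<^sub>L 'v) \<times> ('v \<Rightarrow>\<^sub>L 'v)"
    proof -
      have "norm (cscale (w - v) Z) \<le> norm (w - v) * norm Z * L" by (rule L(2))
      also have "\<dots> \<le> d * (norm ?R * norm X * K) * L"
        using w that L(1) d(1) by (intro mult_right_mono mult_mono) (auto simp: dist_norm)
      also have "\<dots> = d * (norm ?R * K * L) * norm X" by simp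
      also have "\<dots> \<le> 1 / 2 * norm X" using d(2) by (intro mult_right_mono) auto
      finally show ?thesis .
    qed
    have "\<exists>!Z. ?R - cscale (w - v) (pmul ?R Z) = Z"
    proof (rule banach_fix_type[of "1/2"])
      show "\<forall>X Y. dist (?R - cscale (w - v) (pmul ?R X)) (?R - cscale (w - v) (pmul ?R Y)) \<le> 1 / 2 * dist X Y"
      proof (intro allI)
        fix X Y
        have "dist (?R - cscale (w - v) (pmul ?R X)) (?R - cscale (w - v) (pmul ?R Y))
            = norm (cscale (w - v) (pmul ?R (Y - X)))"
          by (simp add: dist_norm cscale.diff_right pmul.diff_right)
        also have "\<dots> \<le> 1 / 2 * norm (Y - X)" by (rule half) (rule K(2))
        finally show "dist (?R - cscale (w - v) (pmul ?R X)) (?R - cscale (w - v) (pmul ?R Y)) \<le> 1 / 2 * dist X Y"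
          by (simp add: dist_norm norm_minus_commute)
      qed
    qed auto
    then obtain X where "?R - cscale (w - v) (pmul ?R X) = X" by blast
    then have X: "X = ?R - cscale (w - v) (pmul ?R X)" by (rule sym)
    have "\<exists>!Z. ?R - cscale (w - v) (pmul Z ?R) = Z"
    proof (rule banach_fix_type[of "1/2"])
      show "\<forall>X Y. dist (?R - cscale (w - v) (pmul X ?R)) (?R - cscale (w - v) (pmul Y ?R)) \<le> 1 / 2 * dist X Y"
      proof (intro allI)
        fix X Y
        have "dist (?R - cscale (w - v) (pmul X ?R)) (?R - cscale (w - v) (pmul Y ?R))
            = norm (cscale (w - v) (pmul (Y - X) ?R))"
          by (simp add: dist_norm cscale.diff_right pmul.diff_left)
        also have "\<dots> \<le> 1 / 2 * norm (Y - X)" by (rule half) (use K(2)[of "Y - X" ?R] in \<open>simp add: mult.commute\<close>)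
        finally show "dist (?R - cscale (w - v) (pmul X ?R)) (?R - cscale (w - v) (pmul Y ?R)) \<le> 1 / 2 * dist X Y"
          by (simp add: dist_norm norm_minus_commute)
      qed
    qed auto
    then obtain Y where "?R - cscale (w - v) (pmul Y ?R) = Y" by blast
    then have Y: "Y = ?R - cscale (w - v) (pmul Y ?R)" by (rule sym)
    have "pmul (pshift B v) X = pmul (pshift B v) (?R - cscale (w - v) (pmul ?R X))"
      by (rule arg_cong[OF X])
    also have "\<dots> = pone - cscale (w - v) X"
      by (simp add: pmul.diff_right pmul_cscale R flip: pmul_assoc)
    finally have 1: "pmul (pshift B w) X = pone"
      by (simp add: pshift_diff[of B w v] pmul.add_left pmul_cscale)
    have "pmul Y (pshift B v) = pmul (?R - cscale (w - v) (pmul Y ?R)) (pshift B v)"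
      by (rule arg_cong[OF Y])
    also have "\<dots> = pone - cscale (w - v) Y"
      by (simp add: pmul.diff_left pmul_cscale R pmul_assoc)
    finally have 2: "pmul Y (pshift B w) = pone"
      by (simp add: pshift_diff[of B w v] pmul.add_right pmul_cscale)
    have "X = Y" using 1 2 by (metis pmul_assoc pmul_one)
    with 1 2 have X': "presolves B w X" by (simp add: presolves_def)
    have "norm X = norm (?R - cscale (w - v) (pmul ?R X))" by (rule arg_cong[OF X])
    also have "\<dots> \<le> norm ?R + norm (cscale (w - v) (pmul ?R X))" by (rule norm_triangle_ineq4)
    finally have "norm X \<le> norm ?R + norm (cscale (w - v) (pmul ?R X))" .
    with half[OF K(2)[of ?R X]] have "norm X \<le> 2 * norm ?R" by simp
    with X' presolvent_eq[OF X'] show ?thesis unfolding presolvent_set_def by blast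
  qed
  with d(1) show ?thesis by blast
qed

lemma open_presolvent_set: "open (presolvent_set (B :: 'v::banach \<Rightarrow>\<^sub>L 'v))"
  unfolding open_dist
proof
  fix v assume "v \<in> presolvent_set B"
  from presolvent_near[OF this] show "\<exists>d>0. \<forall>w. dist w v < d \<longrightarrow> w \<in> presolvent_set B" by blast
qed

text \<open>The local bound on the resolvent turns the resolvent identity into an estimate linear in
  \<open>norm (w - v)\<close>.\<close>

lemma continuous_on_presolvent: "continuous_on (presolvent_set B) (presolvent (B :: 'v::banach \<Rightarrow>\<^sub>L 'v))"
proof -
  have "continuous (at v within presolvent_set B) (presolvent B)" if v: "v \<in> presolvent_set B" for v
  proof -
    let ?R = "presolvent B v"
    obtain d where d: "d > 0" "\<And>w. dist w v < d \<Longrightarrow> w \<in> presolvent_set B \<and> norm (presolvent B w) \<le> 2 * norm ?R"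
      using presolvent_near[OF v] by blast
    obtain K where K: "K > 0" "\<And>X Y::('v \<Rightarrow>\<^sub>L 'v) \<times> ('v \<Rightarrow>\<^sub>L 'v). norm (pmul X Y) \<le> norm X * norm Y * K"
      using pmul.pos_bounded by blast
    obtain L where L: "L > 0" "\<And>c. \<And>X::('v \<Rightarrow>\<^sub>L 'v) \<times> ('v \<Rightarrow>\<^sub>L 'v). norm (cscale c X) \<le> norm c * norm X * L"
      using cscale.pos_bounded by blast
    have bd: "norm (presolvent B w - ?R) \<le> norm (w - v) * (2 * norm ?R * norm ?R * K * L)"
      if w: "w \<in> presolvent_set B" "dist w v < d" for w
    proof -
      have "norm (presolvent B w - ?R) \<le> norm (w - v) * norm (pmul (presolvent B w) ?R) * L"
        using L(2)[of "w - v" "- pmul (presolvent B w) ?R"] by (simp add: presolvent_identity[OF w(1) v])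
      also have "\<dots> \<le> norm (w - v) * (2 * norm ?R * norm ?R * K) * L"
      proof (intro mult_right_mono mult_left_mono)
        have "norm (pmul (presolvent B w) ?R) \<le> norm (presolvent B w) * norm ?R * K" by (rule K(2))
        also have "\<dots> \<le> 2 * norm ?R * norm ?R * K"
          using d(2)[OF w(2)] K(1) by (intro mult_right_mono) auto
        finally show "norm (pmul (presolvent B w) ?R) \<le> 2 * norm ?R * norm ?R * K" .
      qed (use L in auto)
      finally show ?thesis by (simp add: mult.assoc)
    qed
    have "((\<lambda>w. w - v) \<longlongrightarrow> 0) (at v within presolvent_set B)"
      using LIM_zero[OF tendsto_ident_at] by blast
    moreover have "\<forall>\<^sub>F w in at v within presolvent_set B.
        norm (presolvent B w - ?R) \<le> norm (w - v) * (2 * norm ?R * norm ?R * K * L)"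
      using bd d(1) by (auto simp: eventually_at)
    ultimately have "((\<lambda>w. presolvent B w - ?R) \<longlongrightarrow> 0) (at v within presolvent_set B)"
      by (rule tendsto_0_le)
    then show ?thesis by (simp add: continuous_within LIM_zero_iff)
  qed
  then show ?thesis by (simp add: continuous_on_eq_continuous_within)
qed

text \<open>Caratheodory's form of differentiability: the increment factors through a continuous
  cofactor \<open>D\<close>. Every functional maps this factorization to one of the scalar
  increment, with derivative the image of \<open>D v\<close>.\<close>

lemma weakly_holomorphic_onI:
  fixes X :: "complex \<Rightarrow> 'e::real_normed_vector \<times> 'e"
  assumes c: "continuous_on S X"
    and D: "\<And>v. v \<in> S \<Longrightarrow> \<exists>D. (\<forall>w\<in>S. X w - X v = cscale (w - v) (D w)) \<and> continuous_on S D"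
  shows "X weakly_holomorphic_on S"
  unfolding weakly_holomorphic_on_def
proof (intro conjI allI impI c)
  fix \<phi> :: "'e \<Rightarrow> real" assume \<phi>: "bounded_linear \<phi>"
  interpret c\<phi>: bounded_linear "complexify \<phi>" using bounded_linear_complexify[OF \<phi>] .
  show "(\<lambda>z. complexify \<phi> (X z)) holomorphic_on S"
    unfolding holomorphic_on_def field_differentiable_def has_field_derivative_iff
  proof
    fix v assume v: "v \<in> S"
    obtain D where D: "\<And>w. w \<in> S \<Longrightarrow> X w - X v = cscale (w - v) (D w)" "continuous_on S D"
      using D[OF v] by blast
    have lim: "((\<lambda>w. complexify \<phi> (D w)) \<longlongrightarrow> complexify \<phi> (D v)) (at v within S)"
      using D(2) v by (intro c\<phi>.tendsto) (simp add: continuous_on_def)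
    have "(complexify \<phi> (X w) - complexify \<phi> (X v)) / (w - v) = complexify \<phi> (D w)"
      if "w \<in> S" "w \<noteq> v" for w
      using D(1)[OF that(1)] that \<phi>
      by (simp add: complexify_cscale bounded_linear.linear flip: c\<phi>.diff)
    then have "((\<lambda>w. (complexify \<phi> (X w) - complexify \<phi> (X v)) / (w - v))
        \<longlongrightarrow> complexify \<phi> (D v)) (at v within S)"
      by (intro Lim_transform_within[OF lim zero_less_one]) auto
    then show "\<exists>l. ((\<lambda>w. (complexify \<phi> (X w) - complexify \<phi> (X v)) / (w - v)) \<longlongrightarrow> l) (at v within S)"
      by blast
  qed
qed

lemma presolvent_pow_weakly_holomorphic:
  fixes B :: "'v::banach \<Rightarrow>\<^sub>L 'v"
  shows "(\<lambda>w. ppow (presolvent B w) l) weakly_holomorphic_on presolvent_set B"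
proof (rule weakly_holomorphic_onI)
  let ?S = "presolvent_set B"
  have c: "continuous_on ?S (\<lambda>w. ppow (presolvent B w) l)" for l
    by (induction l) (auto simp: ppow_simps intro!: pmul.continuous_on continuous_on_presolvent)
  then show "continuous_on ?S (\<lambda>w. ppow (presolvent B w) l)" .
  show "\<exists>D. (\<forall>w\<in>?S. ppow (presolvent B w) l - ppow (presolvent B v) l = cscale (w - v) (D w)) \<and>
      continuous_on ?S D" if v: "v \<in> ?S" for v
  proof (induction l)
    case 0
    show ?case by (intro exI[of _ "\<lambda>_. 0"]) (simp add: ppow_simps cscale.zero_right)
  next
    case (Suc l)
    then obtain D where D: "\<And>w. w \<in> ?S \<Longrightarrow> ppow (presolvent B w) l - ppow (presolvent B v) l = cscale (w - v) (D w)"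
      "continuous_on ?S D" by blast
    let ?R = "presolvent B" and ?E = "\<lambda>w. - pmul (presolvent B w) (presolvent B v)"
    \<comment> \<open>The product rule for such factorizations, applied to the resolvent and its
      \<open>l\<close>-th power.\<close>
    let ?D = "\<lambda>w. pmul (?R w) (D w) + pmul (?E w) (ppow (?R v) l)"
    have "ppow (?R w) (Suc l) - ppow (?R v) (Suc l) = cscale (w - v) (?D w)" if w: "w \<in> ?S" for w
    proof -
      have "ppow (?R w) (Suc l) - ppow (?R v) (Suc l)
          = pmul (?R w) (ppow (?R w) l - ppow (?R v) l) + pmul (?R w - ?R v) (ppow (?R v) l)"
        by (simp add: ppow_simps pmul.diff_left pmul.diff_right)
      then show ?thesis
        using w v by (simp only: D presolvent_identity pmul_cscale cscale.add_right)
    qed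
    moreover have "continuous_on ?S ?D"
      by (intro continuous_intros pmul.continuous_on continuous_on_presolvent D(2))
    ultimately show ?case by (intro exI[of _ ?D]) auto
  qed
qed

lemma weakly_holomorphic_on_cscale:
  fixes G :: "complex \<Rightarrow> 'e::real_normed_vector \<times> 'e"
  assumes f: "f holomorphic_on S" and G: "G weakly_holomorphic_on S"
  shows "(\<lambda>z. cscale (f z) (G z)) weakly_holomorphic_on S"
  unfolding weakly_holomorphic_on_def
proof (intro conjI allI impI)
  show "continuous_on S (\<lambda>z. cscale (f z) (G z))"
    using G by (intro cscale.continuous_on holomorphic_on_imp_continuous_on[OF f])
      (simp add: weakly_holomorphic_on_def)
  fix \<phi> :: "'e \<Rightarrow> real" assume "bounded_linear \<phi>"
  with G have "(\<lambda>z. f z * complexify \<phi> (G z)) holomorphic_on S"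
    by (intro holomorphic_on_mult f) (simp add: weakly_holomorphic_on_def)
  with \<open>bounded_linear \<phi>\<close> show "(\<lambda>z. complexify \<phi> (cscale (f z) (G z))) holomorphic_on S"
    by (simp add: complexify_cscale bounded_linear.linear)
qed

lemma weakly_holomorphic_on_compose:
  fixes G :: "complex \<Rightarrow> 'e::real_normed_vector \<times> 'e"
  assumes "G weakly_holomorphic_on T" "g holomorphic_on S" "g ` S \<subseteq> T"
  shows "(\<lambda>z. G (g z)) weakly_holomorphic_on S"
  unfolding weakly_holomorphic_on_def
proof (intro conjI allI impI)
  show "continuous_on S (\<lambda>z. G (g z))"
    by (rule continuous_on_compose2[OF _ holomorphic_on_imp_continuous_on[OF assms(2)] assms(3)])
      (use assms(1) in \<open>simp add: weakly_holomorphic_on_def\<close>)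
  fix \<phi> :: "'e \<Rightarrow> real" assume "bounded_linear \<phi>"
  then have "(\<lambda>z. complexify \<phi> (G z)) holomorphic_on T"
    using assms(1) by (simp add: weakly_holomorphic_on_def)
  from holomorphic_on_compose_gen[OF assms(2) this assms(3)]
  show "(\<lambda>z. complexify \<phi> (G (g z))) holomorphic_on S" by (simp add: o_def)
qed

section \<open>The algebra of Clifford operators\<close>

abbreviation symdiff :: "'a set \<Rightarrow> 'a set \<Rightarrow> 'a set" where
  "symdiff A B \<equiv> (A - B) \<union> (B - A)"

text \<open>Elements common to \<open>A\<close> and \<open>B\<close> occur twice on the right and
  contribute the square of \<open>g a\<close>, which is 1.\<close>

lemma prod_symdiff:
  fixes g :: "'a \<Rightarrow> real"
  assumes "finite A" "finite B" "\<And>a. g a * g a = 1"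
  shows "prod g (symdiff A B) = prod g A * prod g B"
proof -
  have "prod g (A \<inter> B) * prod g (A \<inter> B) = 1" by (simp add: assms(3) flip: prod.distrib)
  moreover have "prod g X = prod g (X - Y) * prod g (X \<inter> Y)" if "finite X" for X Y
    using that by (subst prod.union_disjoint[symmetric]) (auto simp: Un_Diff_Int)
  note this[OF assms(1), of B] this[OF assms(2), of A]
  moreover have "prod g (symdiff A B) = prod g (A - B) * prod g (B - A)"
    using assms by (intro prod.union_disjoint) auto
  ultimately show ?thesis by (simp add: Int_commute)
qed

text \<open>Inversions have \<open>b < a\<close> and repeated generators \<open>b = a\<close>, so
  together they are the pairs with \<open>b \<le> a\<close>, each contributing one factor
  -1.\<close>

lemma basis_sign_prod:
  fixes A B :: "'n::{finite,linorder} set"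
  shows "basis_sign A B = (\<Prod>a\<in>A. \<Prod>b\<in>B. if b \<le> a then - 1 else 1)"
proof -
  have "{p \<in> A \<times> B. snd p \<le> fst p} = {(a, b). a \<in> A \<and> b \<in> B \<and> b < a} \<union> (\<lambda>a. (a, a)) ` (A \<inter> B)"
    by auto
  then have "card {p \<in> A \<times> B. snd p \<le> fst p} = card {(a, b). a \<in> A \<and> b \<in> B \<and> b < a} + card (A \<inter> B)"
    by (simp only:) (subst card_Un_disjoint, auto simp: card_image inj_on_def)
  moreover have "(\<Prod>a\<in>A. \<Prod>b\<in>B. if b \<le> a then - 1 else 1) = (\<Prod>p\<in>A \<times> B. if snd p \<le> fst p then - 1 else (1::real))"
    by (simp add: prod.cartesian_product')
  moreover have "\<dots> = (\<Prod>p\<in>{p \<in> A \<times> B. snd p \<le> fst p}. - 1)"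
    by (rule prod.inter_filter[symmetric]) simp
  ultimately show ?thesis by (simp add: basis_sign_def)
qed

text \<open>Multiplicativity in each argument is what makes the product associative: both
  bracketings of three basis elements carry the sign
  \<open>basis_sign A B * basis_sign A C * basis_sign B C\<close>.\<close>

lemma basis_sign_symdiff:
  fixes A B C :: "'n::{finite,linorder} set"
  shows "basis_sign (symdiff A B) C = basis_sign A C * basis_sign B C"
    and "basis_sign C (symdiff A B) = basis_sign C A * basis_sign C B"
proof -
  let ?g = "\<lambda>a b. if b \<le> a then - 1 else (1::real)"
  have sq: "(\<Prod>b\<in>C. ?g a b) * (\<Prod>b\<in>C. ?g a b) = 1" for a C
    by (simp flip: prod.distrib) (auto intro: prod.neutral)
  show "basis_sign (symdiff A B) C = basis_sign A C * basis_sign B C"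
    unfolding basis_sign_prod by (intro prod_symdiff sq) auto
  show "basis_sign C (symdiff A B) = basis_sign C A * basis_sign C B"
    unfolding basis_sign_prod by (subst prod_symdiff) (auto simp: prod.distrib)
qed

lemma basis_sign_empty [simp]: "basis_sign {} A = 1" "basis_sign A {} = 1"
  by (simp_all add: basis_sign_def)

lemma norm_axis: "norm (axis i x :: 'a::real_normed_vector ^ 'n) = norm x"
proof -
  have "norm (axis i x) = sqrt (\<Sum>j\<in>UNIV. if j = i then (norm x)\<^sup>2 else 0)"
    unfolding norm_vec_def L2_set_def by (intro arg_cong[where f = sqrt] sum.cong) (auto simp: axis_def)
  then show ?thesis by simp
qed

lemma axis_linear:
  "axis i (x + y) = axis i x + axis i y" "axis i (x - y) = axis i x - axis i y"
  "axis i (- x) = - axis i x" "axis i (c *\<^sub>R x) = c *\<^sub>R axis i x" "axis i 0 = 0"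
  for x y :: "'a::real_vector"
  by (auto simp: vec_eq_iff axis_def)

lemma axis_sum: "axis i (\<Sum>k\<in>K. x k) = (\<Sum>k\<in>K. axis i (x k))" for x :: "'k \<Rightarrow> 'a::real_vector"
  by (induction K rule: infinite_finite_induct) (auto simp: axis_linear)

lemma bounded_linear_axis: "bounded_linear (axis i)"
  by (rule bounded_linear_intro[of _ 1]) (auto simp: axis_linear norm_axis)

lemma axis_expansion: "x = (\<Sum>A\<in>UNIV. axis A (x $ A))" for x :: "'a::real_vector ^ 'i::finite"
  by (auto simp: vec_eq_iff axis_def if_distrib cong: if_cong)

lemma omul_expansion:
  fixes S T :: "('v::real_normed_vector, 'n::{finite,linorder}) cliff_op"
  shows "S \<odot> T = (\<Sum>A\<in>UNIV. \<Sum>B\<in>UNIV. axis (symdiff A B) (basis_sign A B *\<^sub>R (S $ A o\<^sub>L T $ B)))"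
proof -
  have "(S \<odot> T) $ C = (\<Sum>A\<in>UNIV. \<Sum>B\<in>UNIV. axis (symdiff A B) (basis_sign A B *\<^sub>R (S $ A o\<^sub>L T $ B))) $ C" for C
  proof -
    have "(S \<odot> T) $ C = (\<Sum>p\<in>{p \<in> UNIV \<times> UNIV. symdiff (fst p) (snd p) = C}.
        basis_sign (fst p) (snd p) *\<^sub>R (S $ fst p o\<^sub>L T $ snd p))"
      unfolding cliff_mult_def vec_lambda_beta by (rule sum.cong) (auto simp: case_prod_beta)
    also have "\<dots> = (\<Sum>p\<in>UNIV \<times> UNIV. if symdiff (fst p) (snd p) = C
        then basis_sign (fst p) (snd p) *\<^sub>R (S $ fst p o\<^sub>L T $ snd p) else 0)"
      by (rule sum.inter_filter) simp
    also have "\<dots> = (\<Sum>A\<in>UNIV. \<Sum>B\<in>UNIV. if symdiff A B = C then basis_sign A B *\<^sub>R (S $ A o\<^sub>L T $ B) else 0)"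
      by (simp only: sum.cartesian_product' fst_conv snd_conv)
    finally show ?thesis by (simp add: axis_def eq_commute[of C])
  qed
  then show ?thesis by (simp add: vec_eq_iff)
qed

lemma omul_axis:
  fixes X Y :: "'v::real_normed_vector \<Rightarrow>\<^sub>L 'v" and A B :: "'n::{finite,linorder} set"
  shows "axis A X \<odot> axis B Y = axis (symdiff A B) (basis_sign A B *\<^sub>R (X o\<^sub>L Y))"
proof -
  have "axis A X \<odot> axis B Y = (\<Sum>A'\<in>UNIV. \<Sum>B'\<in>UNIV.
      if A' = A \<and> B' = B then axis (symdiff A B) (basis_sign A B *\<^sub>R (X o\<^sub>L Y)) else 0)"
    unfolding omul_expansion
    by (intro sum.cong) (auto simp: axis_def[of A X] axis_def[of B Y] blinfun_compose_simps axis_linear)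
  also have "\<dots> = (\<Sum>A'\<in>UNIV. if A' = A then axis (symdiff A B) (basis_sign A B *\<^sub>R (X o\<^sub>L Y)) else 0)"
    by (intro sum.cong) auto
  finally show ?thesis by simp
qed

lemma bounded_bilinear_omul:
  "bounded_bilinear (cliff_mult (o\<^sub>L) :: ('v::real_normed_vector, 'n::{finite,linorder}) cliff_op \<Rightarrow>
    ('v, 'n) cliff_op \<Rightarrow> ('v, 'n) cliff_op)"
proof
  fix S S' T T' :: "('v, 'n) cliff_op" and r :: real
  show "(S + S') \<odot> T = S \<odot> T + S' \<odot> T" "S \<odot> (T + T') = S \<odot> T + S \<odot> T'"
    "(r *\<^sub>R S) \<odot> T = r *\<^sub>R (S \<odot> T)" "S \<odot> (r *\<^sub>R T) = r *\<^sub>R (S \<odot> T)"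
    by (simp_all add: omul_expansion blinfun_compose_simps axis_linear scaleR_add_right sum.distrib
        scaleR_sum_right mult.commute)
  have "norm (S \<odot> T) \<le> norm S * norm T * (real (card (UNIV::'n set set)) * real (card (UNIV::'n set set)))"
    for S T :: "('v, 'n) cliff_op"
  proof -
    have "norm (axis (symdiff A B) (basis_sign A B *\<^sub>R (S $ A o\<^sub>L T $ B))) \<le> norm S * norm T" for A B
    proof -
      have "\<bar>basis_sign A B\<bar> = 1" by (simp add: basis_sign_def power_abs)
      then have "norm (axis (symdiff A B) (basis_sign A B *\<^sub>R (S $ A o\<^sub>L T $ B))) = norm (S $ A o\<^sub>L T $ B)"
        by (simp add: norm_axis)
      also have "\<dots> \<le> norm (S $ A) * norm (T $ B)" by (rule norm_blinfun_compose)
      also have "\<dots> \<le> norm S * norm T" by (intro mult_mono Finite_Cartesian_Product.norm_nth_le) auto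
      finally show ?thesis .
    qed
    then have "norm (S \<odot> T) \<le> (\<Sum>A\<in>(UNIV::'n set set). \<Sum>B\<in>(UNIV::'n set set). norm S * norm T)"
      unfolding omul_expansion by (intro sum_norm_le) auto
    then show ?thesis by (simp add: mult_ac)
  qed
  then show "\<exists>K. \<forall>S T. norm (S \<odot> (T::('v, 'n) cliff_op)) \<le> norm S * norm T * K" by blast
qed

interpretation omul: bounded_bilinear "cliff_mult (o\<^sub>L) ::
    ('v::real_normed_vector, 'n::{finite,linorder}) cliff_op \<Rightarrow> ('v, 'n) cliff_op \<Rightarrow> ('v, 'n) cliff_op" by (rule bounded_bilinear_omul)

lemma omul_axis_assoc:
  fixes X Y Z :: "'v::real_normed_vector \<Rightarrow>\<^sub>L 'v" and A B C :: "'n::{finite,linorder} set"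
  shows "(axis A X \<odot> axis B Y) \<odot> axis C Z = axis A X \<odot> (axis B Y \<odot> axis C Z)"
proof -
  have "symdiff (symdiff A B) C = symdiff A (symdiff B C)" by blast
  then show ?thesis
    by (simp only: omul_axis basis_sign_symdiff blinfun_compose_simps blinfun_compose_assoc
        scaleR_scaleR mult_ac)
qed

lemma omul_assoc: "(R \<odot> S) \<odot> T = R \<odot> (S \<odot> T)"
  for R S T :: "('v::real_normed_vector, 'n::{finite,linorder}) cliff_op"
proof -
  have "((\<Sum>A\<in>UNIV. axis A (R $ A)) \<odot> (\<Sum>A\<in>UNIV. axis A (S $ A))) \<odot> (\<Sum>A\<in>UNIV. axis A (T $ A))
    = (\<Sum>A\<in>UNIV. axis A (R $ A)) \<odot> ((\<Sum>A\<in>UNIV. axis A (S $ A)) \<odot> (\<Sum>A\<in>UNIV. axis A (T $ A)))"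
    by (simp only: omul.sum_left omul.sum_right omul_axis_assoc)
  then show ?thesis by (simp only: axis_expansion[symmetric])
qed

lemma scal_omul_nth:
  fixes S :: "('v::real_normed_vector, 'n::{finite,linorder}) cliff_op"
  shows "(axis {} X \<odot> S) $ A = X o\<^sub>L S $ A" "(S \<odot> axis {} X) $ A = S $ A o\<^sub>L X"
proof -
  have "axis {} X \<odot> (\<Sum>A\<in>UNIV. axis A (S $ A)) = (\<Sum>A\<in>UNIV. axis A (X o\<^sub>L S $ A))"
    "(\<Sum>A\<in>UNIV. axis A (S $ A)) \<odot> axis {} X = (\<Sum>A\<in>UNIV. axis A (S $ A o\<^sub>L X))"
    by (simp_all add: omul.sum_left omul.sum_right omul_axis)
  then show "(axis {} X \<odot> S) $ A = X o\<^sub>L S $ A" "(S \<odot> axis {} X) $ A = S $ A o\<^sub>L X"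
    by (simp_all only: axis_expansion[symmetric])
      (simp_all add: axis_def if_distrib cong: if_cong)
qed

lemma emb_axis: "emb (axis A c) = axis A (c *\<^sub>R id_blinfun)"
  by (simp add: emb_def vec_eq_iff axis_def)

lemma omul_one [simp]:
  fixes S :: "('v::real_normed_vector, 'n::{finite,linorder}) cliff_op"
  shows "op_one \<odot> S = S" "S \<odot> op_one = S"
  by (simp_all add: vec_eq_iff emb_axis scal_omul_nth)

lemma emb_linear: "emb (a + b) = emb a + emb b" "emb (r *\<^sub>R a) = r *\<^sub>R emb a" "emb (- a) = - emb a"
  by (simp_all add: emb_def vec_eq_iff scaleR_add_left)

lemma emb_sum: "emb (\<Sum>k\<in>K. a k) = (\<Sum>k\<in>K. emb (a k))"
  by (simp add: emb_def vec_eq_iff scaleR_sum_left)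

lemma emb_cmul: "emb (a \<star> b) = emb a \<odot> emb b"
  by (simp add: emb_def cliff_mult_def vec_eq_iff case_prod_beta scaleR_sum_left
      blinfun_compose_simps mult_ac)

lemma emb_scal_commute:
  fixes X :: "'v::real_normed_vector \<Rightarrow>\<^sub>L 'v" and c :: "'n::{finite,linorder} clifford"
  shows "emb c \<odot> axis {} X = axis {} X \<odot> emb c"
  by (simp add: vec_eq_iff scal_omul_nth emb_def blinfun_compose_simps)

section \<open>The grade involution and squares of vectors\<close>

definition grade_involution :: "('v::real_normed_vector, 'n::{finite,linorder}) cliff_op \<Rightarrow> ('v, 'n) cliff_op" where
  "grade_involution S = (\<chi> A. (- 1) ^ card A *\<^sub>R S $ A)"

lemma grade_involution_nth: "grade_involution S $ A = (- 1) ^ card A *\<^sub>R S $ A"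
  by (simp add: grade_involution_def)

lemma grade_involution_linear:
  "grade_involution (S + T) = grade_involution S + grade_involution T"
  "grade_involution (c *\<^sub>R S) = c *\<^sub>R grade_involution S"
  by (simp_all add: grade_involution_def vec_eq_iff scaleR_add_right)

lemma grade_involution_sum: "grade_involution (\<Sum>k\<in>K. S k) = (\<Sum>k\<in>K. grade_involution (S k))"
  by (simp add: grade_involution_def vec_eq_iff scaleR_sum_right)

lemma grade_involution_axis: "grade_involution (axis A X) = axis A ((- 1) ^ card A *\<^sub>R X)"
  by (simp add: grade_involution_def vec_eq_iff axis_def)

text \<open>The parity of the cardinality is additive under symmetric difference; this is
  \<open>prod_symdiff\<close> for the constant -1.\<close>

lemma grade_involution_omul:
  fixes S T :: "('v::real_normed_vector, 'n::{finite,linorder}) cliff_op"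
  shows "grade_involution (S \<odot> T) = grade_involution S \<odot> grade_involution T"
proof -
  have card: "(- 1 :: real) ^ card (symdiff A B) = (- 1) ^ card A * (- 1) ^ card B" for A B :: "'n set"
    using prod_symdiff[of A B "\<lambda>_. - 1"] by simp
  show ?thesis
    by (subst (1 2) omul_expansion)
      (simp add: grade_involution_sum grade_involution_axis card blinfun_compose_simps
        grade_involution_nth mult_ac)
qed

text \<open>Distinct generators anticommute while their coefficients commute, so mixed terms cancel
  in pairs once the double sum is added to its transpose. The lemma serves both \<open>T\<close> and
  the imaginary unit.\<close>

lemma omul_self_vector:
  fixes T :: "('v::real_normed_vector, 'n::{finite,linorder}) cliff_op"
  assumes vec: "\<And>A. card A \<noteq> 1 \<Longrightarrow> T $ A = 0"
    and comm: "\<And>A B. T $ A o\<^sub>L T $ B = T $ B o\<^sub>L T $ A"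
  shows "T \<odot> T = axis {} (- (\<Sum>i\<in>UNIV. T $ {i} o\<^sub>L T $ {i}))"
proof -
  let ?t = "\<lambda>i j. axis {i} (T $ {i}) \<odot> axis {j} (T $ {j})"
  have "(\<Sum>A\<in>UNIV. axis A (T $ A)) = (\<Sum>A\<in>(\<lambda>i. {i}) ` UNIV. axis A (T $ A))"
    using vec by (intro sum.mono_neutral_right) (auto simp: axis_linear card_1_singleton_iff)
  also have "\<dots> = (\<Sum>i\<in>UNIV. axis {i} (T $ {i}))"
    by (subst sum.reindex) auto
  finally have T: "T = (\<Sum>i\<in>UNIV. axis {i} (T $ {i}))" by (simp only: axis_expansion[symmetric])
  have anti: "?t i j + ?t j i = (if i = j then axis {} (- 2 *\<^sub>R (T $ {i} o\<^sub>L T $ {i})) else 0)" for i j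
  proof (cases "i = j")
    case True
    then show ?thesis
      by (simp add: omul_axis basis_sign_prod scaleR_2 flip: axis_linear)
  next
    case False
    then have "symdiff {j} {i} = symdiff {i} {j}" "basis_sign {j} {i} = - basis_sign {i} {j}"
      by (auto simp: basis_sign_prod)
    with False show ?thesis by (simp only: omul_axis comm[of "{j}"]) (simp add: axis_linear)
  qed
  have TT: "T \<odot> T = (\<Sum>i\<in>UNIV. \<Sum>j\<in>UNIV. ?t i j)"
    by (subst T, subst (2) T) (simp only: omul.sum_left, simp only: omul.sum_right)
  have "2 *\<^sub>R (T \<odot> T) = (\<Sum>i\<in>UNIV. \<Sum>j\<in>UNIV. ?t i j + ?t j i)"
  proof -
    have "(\<Sum>i\<in>UNIV. \<Sum>j\<in>UNIV. ?t j i) = (\<Sum>i\<in>UNIV. \<Sum>j\<in>UNIV. ?t i j)" by (rule sum.swap)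
    from arg_cong[where f = "(+) (\<Sum>i\<in>UNIV. \<Sum>j\<in>UNIV. ?t i j)", OF this[symmetric]]
    show ?thesis unfolding sum.distrib scaleR_2 TT .
  qed
  also have "\<dots> = 2 *\<^sub>R axis {} (- (\<Sum>i\<in>UNIV. T $ {i} o\<^sub>L T $ {i}))"
    by (simp only: anti sum.delta finite_UNIV)
      (simp add: axis_linear axis_sum scaleR_sum_right sum_negf)
  finally show ?thesis by (simp only: scaleR_cancel_left) simp
qed

section \<open>The \<open>S\<close>-resolvent set\<close>

text \<open>The homomorphism \<open>\<i> \<mapsto> I\<close> from the complexification of \<open>\<B>(V)\<close> to \<open>\<B>(V\<^sub>n)\<close>.\<close>

definition kappa :: "'n::{finite,linorder} rvec \<Rightarrow> ('v::real_normed_vector \<Rightarrow>\<^sub>L 'v) \<times> ('v \<Rightarrow>\<^sub>L 'v) \<Rightarrow> ('v, 'n) cliff_op" where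
  "kappa I X = axis {} (fst X) + emb (paravec (0, I)) \<odot> axis {} (snd X)"

lemma paravec_unit_nth:
  "paravec (0, I) $ A = (if card A = 1 then I $ the_elem A else 0)"
proof -
  have "(\<Sum>i\<in>UNIV. axis {i} (I $ i)) $ A = (\<Sum>i\<in>UNIV. if A = {i} then I $ i else 0)"
    by (simp add: axis_def)
  also have "\<dots> = (if card A = 1 then I $ the_elem A else 0)"
    by (auto simp: card_1_singleton_iff)
  finally show ?thesis by (simp add: paravec_def axis_linear)
qed

lemma imaginary_unit_square:
  fixes I :: "'n::{finite,linorder} rvec"
  assumes "norm I = 1"
  shows "emb (paravec (0, I)) \<odot> emb (paravec (0, I)) = (- op_one :: ('v::real_normed_vector, 'n) cliff_op)"
proof -
  let ?J = "emb (paravec (0, I)) :: ('v, 'n) cliff_op"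
  have "?J \<odot> ?J = axis {} (- (\<Sum>i\<in>UNIV. ?J $ {i} o\<^sub>L ?J $ {i}))"
    by (rule omul_self_vector)
      (auto simp: emb_def paravec_unit_nth blinfun_compose_simps mult.commute)
  also have "(\<Sum>i\<in>UNIV. ?J $ {i} o\<^sub>L ?J $ {i}) = (\<Sum>i\<in>UNIV. (I $ i)\<^sup>2) *\<^sub>R id_blinfun"
    by (simp add: emb_def paravec_unit_nth blinfun_compose_simps power2_eq_square scaleR_sum_left)
  also have "(\<Sum>i\<in>UNIV. (I $ i)\<^sup>2) = 1"
    using assms by (simp add: norm_vec_def L2_set_def)
  finally show ?thesis by (simp add: emb_axis axis_linear)
qed

text \<open>Two facts make this a homomorphism: a unit vector squares to -1, and constants from the
  Clifford algebra commute with operators from \<B>(V).\<close>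

lemma kappa_pmul:
  fixes I :: "'n::{finite,linorder} rvec" and X Y :: "('v::real_normed_vector \<Rightarrow>\<^sub>L 'v) \<times> ('v \<Rightarrow>\<^sub>L 'v)"
  assumes "norm I = 1"
  shows "kappa I X \<odot> kappa I Y = kappa I (pmul X Y)"
proof -
  let ?J = "emb (paravec (0, I)) :: ('v, 'n) cliff_op"
  have scal: "axis {} P \<odot> axis {} Q = axis {} (P o\<^sub>L Q)" for P Q :: "'v \<Rightarrow>\<^sub>L 'v"
    by (simp add: omul_axis)
  have J: "?J \<odot> (?J \<odot> S) = - S" for S
    using imaginary_unit_square[OF assms, where 'v = 'v] by (simp add: omul.minus_left flip: omul_assoc)
  have JJ: "?J \<odot> axis {} P \<odot> (?J \<odot> axis {} Q) = - axis {} (P o\<^sub>L Q)" for P Q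
    using J[of "axis {} P \<odot> axis {} Q"] by (simp add: omul_assoc scal) (metis emb_scal_commute omul_assoc scal)
  have 1: "axis {} P \<odot> (?J \<odot> axis {} Q) = ?J \<odot> axis {} (P o\<^sub>L Q)" for P Q
    by (metis emb_scal_commute omul_assoc scal)
  have 2: "?J \<odot> axis {} P \<odot> axis {} Q = ?J \<odot> axis {} (P o\<^sub>L Q)" for P Q
    by (simp add: omul_assoc scal)
  show ?thesis
    unfolding kappa_def pmul_def fst_conv snd_conv omul.add_left omul.add_right JJ 1 2 scal axis_linear
      omul.diff_right
    by (simp add: algebra_simps)
qed

lemma kappa_pone [simp]: "kappa I pone = op_one"
  by (simp add: kappa_def pone_def emb_axis axis_linear omul.zero_right)

lemma kappa_linear: "kappa I (X + Y) = kappa I X + kappa I Y" "kappa I (r *\<^sub>R X) = r *\<^sub>R kappa I X"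
  by (simp_all add: kappa_def axis_linear omul.add_right omul.scaleR_right scaleR_add_right)

lemma bounded_linear_kappa: "bounded_linear (kappa I)"
  unfolding kappa_def
  by (intro bounded_linear_add bounded_linear_compose[OF bounded_linear_axis]
      bounded_linear_compose[OF omul.bounded_linear_right] bounded_linear_fst bounded_linear_snd)

lemma kappa_cscale_pone:
  "kappa I (cscale c pone) = emb (axis {} (Re c) + Im c *\<^sub>R paravec (0, I))"
proof -
  have "kappa I (cscale c pone) = emb (axis {} (Re c)) + emb (paravec (0, I)) \<odot> emb (axis {} (Im c))"
    by (simp add: kappa_def cscale_def pone_def emb_axis)
  also have "emb (axis {} (Im c)) = Im c *\<^sub>R op_one"
    by (simp add: emb_axis axis_linear)
  finally show ?thesis by (simp add: emb_linear omul.scaleR_right)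
qed

lemma paravec_slice_pt: "paravec (slice_pt I z) = axis {} (Re z) + Im z *\<^sub>R paravec (0, I)"
  by (simp add: paravec_def slice_pt_def axis_linear(5) scaleR_sum_right flip: axis_linear(4))

lemma emb_slice_pt: "emb (paravec (slice_pt I z)) = kappa I (cscale z pone)"
  by (simp add: kappa_cscale_pone paravec_slice_pt)

text \<open>The differential is a complex scalar in the image of \<open>kappa I\<close>, just like
  the kernel; the factor \<open>- \<i>\<close> is the \<open>-I\<close> of
  \<open>ds_I\<close>.\<close>

lemma emb_dsI:
  fixes I :: "'n::{finite,linorder} rvec"
  assumes "norm I = 1"
  shows "emb (dsI I \<gamma> t) = (kappa I (cscale (vector_derivative \<gamma> (at t within {0..1}) * - \<i>) pone)
    :: ('v::real_normed_vector, 'n) cliff_op)"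
proof -
  have "emb (- paravec (0, I)) = (kappa I (cscale (- \<i>) pone) :: ('v, 'n) cliff_op)"
    by (simp add: kappa_cscale_pone axis_linear)
  then show ?thesis
    by (simp add: dsI_def emb_cmul emb_slice_pt kappa_pmul[OF assms] pmul_cscale cscale_cscale mult.commute)
qed

section \<open>The kernel on a slice and its singularities\<close>

definition sum_of_squares :: "('v::real_normed_vector, 'n::{finite,linorder}) cliff_op \<Rightarrow> 'v \<Rightarrow>\<^sub>L 'v" where
  "sum_of_squares T = (\<Sum>i\<in>UNIV. T $ {i} o\<^sub>L T $ {i})"

lemma BC1_nth: "T \<in> BC1 \<Longrightarrow> card A \<noteq> 1 \<Longrightarrow> T $ A = 0"
proof -
  assume "T \<in> BC1" "card A \<noteq> 1"
  then show "T $ A = 0"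
    by (cases "A = {}") (auto simp: BC1_def BC01_def numeral_2_eq_2 Suc_le_eq neq_iff)
qed

lemma BC1_square:
  assumes "T \<in> BC1"
  shows "T \<odot> T = axis {} (- sum_of_squares T)"
  unfolding sum_of_squares_def
  using assms by (intro omul_self_vector BC1_nth) (auto simp: BC1_def BC01_def)

text \<open>The sum of squares is the negative of the square of \<open>T\<close>, with which
  \<open>T\<close> commutes by associativity.\<close>

lemma BC1_sum_of_squares_commute:
  assumes "T \<in> BC1"
  shows "T \<odot> axis {} (sum_of_squares T) = axis {} (sum_of_squares T) \<odot> T"
proof -
  have "T \<odot> (T \<odot> T) = (T \<odot> T) \<odot> T" by (simp add: omul_assoc)
  then show ?thesis by (simp add: BC1_square[OF assms] axis_linear omul.minus_left omul.minus_right)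
qed

lemma Qc_slice_pt:
  fixes T :: "('v::real_normed_vector, 'n::{finite,linorder}) cliff_op"
  assumes T: "T \<in> BC1" and I: "norm I = 1"
  shows "Qc (slice_pt I z) T = kappa I (pshift (sum_of_squares T) (z\<^sup>2))"
proof -
  \<comment> \<open>Since \<open>T\<close> has no scalar part, the linear term of \<open>Qc\<close>
    drops out and its last term is minus the square of \<open>T\<close>.\<close>
  have conj: "op_conj T = - T"
    using T by (simp add: op_conj_def BC1_def vec_eq_iff)
  have "emb (paravec (slice_pt I z) \<star> paravec (slice_pt I z)) = (kappa I (cscale (z\<^sup>2) pone) :: ('v, 'n) cliff_op)"
    by (simp add: emb_cmul emb_slice_pt kappa_pmul[OF I] pmul_cscale cscale_cscale power2_eq_square)
  then show ?thesis
    by (simp add: Qc_def conj omul.minus_right BC1_square[OF T] pshift_def kappa_linear omul.zero_right axis_linear)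
      (simp add: kappa_def omul.zero_right axis_linear)
qed

lemma is_op_inverse_unique:
  "is_op_inverse Q S \<Longrightarrow> is_op_inverse Q S' \<Longrightarrow> S = S'"
  unfolding is_op_inverse_def by (metis omul_assoc omul_one)

lemma op_inv_eq: "is_op_inverse Q S \<Longrightarrow> op_inv Q = S"
  unfolding op_inv_def by (blast intro: the_equality is_op_inverse_unique)

lemma op_power_kappa:
  assumes "norm I = 1"
  shows "op_power (kappa I X) l = kappa I (ppow X l)"
  by (induction l) (simp_all add: op_power_def ppow_def kappa_pmul[OF assms])

lemma Qc_inverse:
  fixes T :: "('v::real_normed_vector, 'n::{finite,linorder}) cliff_op"
  assumes T: "T \<in> BC1" and I: "norm I = 1" and z: "z\<^sup>2 \<in> presolvent_set (sum_of_squares T)"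
  shows "is_op_inverse (Qc (slice_pt I z) T) (kappa I (presolvent (sum_of_squares T) (z\<^sup>2)))"
  using presolves_presolvent[OF z]
  by (simp add: is_op_inverse_def Qc_slice_pt[OF T I] kappa_pmul[OF I] presolves_def)

lemma H_kernel_slice_pt:
  fixes T :: "('v::real_normed_vector, 'n::{finite,linorder}) cliff_op"
  assumes T: "T \<in> BC1" and I: "norm I = 1" and z: "z\<^sup>2 \<in> presolvent_set (sum_of_squares T)"
  shows "H_kernel l (slice_pt I z) T
    = sigma_const TYPE('n) l *\<^sub>R kappa I (ppow (presolvent (sum_of_squares T) (z\<^sup>2)) l)"
  by (simp add: H_kernel_def op_inv_eq[OF Qc_inverse[OF assms]] op_power_kappa[OF I])

text \<open>With \<open>a = |z|^2 - B\<close> and \<open>b = 2 Re z\<close>, the operator defining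
  the \<open>S\<close>-spectrum is \<open>a - b T\<close>. Its product with \<open>a + b T\<close>
  is \<open>P = a^2 + b^2 B\<close>, which is also the product of \<open>z^2 + B\<close> and its
  conjugate. So inverting \<open>P\<close> within \<B>(V) inverts \<open>z^2 + B\<close>.\<close>

lemma presolvent_set_of_S_resolvent:
  fixes T :: "('v::real_normed_vector, 'n::{finite,linorder}) cliff_op"
  assumes T: "T \<in> BC1" and I: "norm I = 1" and z: "slice_pt I z \<notin> S_spectrum T"
  shows "z\<^sup>2 \<in> presolvent_set (sum_of_squares T)"
proof -
  define B where "B = sum_of_squares T"
  define a where "a = (norm z)\<^sup>2 *\<^sub>R id_blinfun - B"
  define b where "b = 2 * Re z"
  define P where "P = (a o\<^sub>L a) + b\<^sup>2 *\<^sub>R B"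
  have nz: "(norm (slice_pt I z))\<^sup>2 = (norm z)\<^sup>2"
    using I by (simp add: slice_pt_def norm_Pair cmod_power2 power_mult_distrib)
  have "op_invertible (T \<odot> T - (2 * fst (slice_pt I z)) *\<^sub>R T + (norm (slice_pt I z))\<^sup>2 *\<^sub>R op_one)"
    using z by (simp add: S_spectrum_def)
  moreover have "T \<odot> T - (2 * fst (slice_pt I z)) *\<^sub>R T + (norm (slice_pt I z))\<^sup>2 *\<^sub>R op_one = axis {} a - b *\<^sub>R T"
    unfolding nz by (simp add: BC1_square[OF T] a_def b_def B_def slice_pt_def emb_axis axis_linear)
  ultimately obtain S where S: "(axis {} a - b *\<^sub>R T) \<odot> S = op_one" "S \<odot> (axis {} a - b *\<^sub>R T) = op_one"
    by (auto simp: op_invertible_def is_op_inverse_def)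
  have "grade_involution T $ A = (- T) $ A" for A
    using BC1_nth[OF T, of A] by (cases "card A = 1") (simp_all add: grade_involution_nth)
  then have "grade_involution T = - T" by (simp add: vec_eq_iff)
  then have "grade_involution (axis {} a + (- b) *\<^sub>R T) = axis {} a + (- b) *\<^sub>R (- T)"
    by (simp only: grade_involution_linear grade_involution_axis) simp
  then have inv: "grade_involution (axis {} a - b *\<^sub>R T) = axis {} a + b *\<^sub>R T" by simp
  have inv1: "grade_involution (op_one :: ('v, 'n) cliff_op) = op_one"
    by (simp add: emb_axis grade_involution_axis)
  define S' where "S' = grade_involution S"
  have S': "(axis {} a + b *\<^sub>R T) \<odot> S' = op_one" "S' \<odot> (axis {} a + b *\<^sub>R T) = op_one"
    using S[THEN arg_cong[of _ _ grade_involution]] by (simp_all add: grade_involution_omul inv inv1 S'_def)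
  have aT: "T \<odot> axis {} a = axis {} a \<odot> T"
    using BC1_sum_of_squares_commute[OF T]
    by (simp add: a_def B_def axis_linear omul.diff_left omul.diff_right omul.scaleR_left omul.scaleR_right
        flip: emb_axis[of "{}" 1, simplified])
  have P: "(axis {} a - b *\<^sub>R T) \<odot> (axis {} a + b *\<^sub>R T) = axis {} P"
    by (simp add: P_def B_def omul.add_left omul.add_right omul.diff_left omul.diff_right omul.scaleR_left
        omul.scaleR_right aT omul_axis BC1_square[OF T] axis_linear power2_eq_square scaleR_add_right)
  \<comment> \<open>Multiplication by \<open>axis {} P\<close> acts coefficientwise, so the scalar
    coefficient of an inverse of it is an inverse of \<open>P\<close> in \<B>(V).\<close>
  define Y where "Y = (S' \<odot> S) $ {}"
  have "axis {} P \<odot> (S' \<odot> S) = op_one" "(S' \<odot> S) \<odot> axis {} P = op_one"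
    unfolding P[symmetric] by (metis S S' omul_assoc omul_one)+
  from this[THEN arg_cong[of _ _ "\<lambda>S. S $ {}"]] have Y: "P o\<^sub>L Y = id_blinfun" "Y o\<^sub>L P = id_blinfun"
    by (simp_all add: scal_omul_nth Y_def emb_axis)
  have "B o\<^sub>L P = P o\<^sub>L B"
    by (simp add: P_def a_def blinfun_compose_simps blinfun_compose_assoc)
  then have YB: "Y o\<^sub>L B = B o\<^sub>L Y" by (metis Y blinfun_compose_assoc id_blinfun_compose)
  have Pz: "P = (Re (z\<^sup>2))\<^sup>2 *\<^sub>R id_blinfun + (2 * Re (z\<^sup>2)) *\<^sub>R B + (B o\<^sub>L B) + (Im (z\<^sup>2))\<^sup>2 *\<^sub>R id_blinfun"
  proof -
    have "P = ((norm z)\<^sup>2)\<^sup>2 *\<^sub>R id_blinfun + (b\<^sup>2 - 2 * (norm z)\<^sup>2) *\<^sub>R B + (B o\<^sub>L B)"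
      by (simp add: P_def a_def blinfun_compose_simps algebra_simps power2_eq_square[of "(norm z)\<^sup>2"])
        (simp only: mult_2 scaleR_add_left)
    moreover have "((norm z)\<^sup>2)\<^sup>2 = (Re (z\<^sup>2))\<^sup>2 + (Im (z\<^sup>2))\<^sup>2"
      by (metis cmod_power2 norm_power)
    moreover have "b\<^sup>2 - 2 * (norm z)\<^sup>2 = 2 * Re (z\<^sup>2)"
      by (simp add: b_def cmod_power2) (simp add: power2_eq_square algebra_simps)
    ultimately show ?thesis by (simp add: algebra_simps)
  qed
  define p where "p = Re (z\<^sup>2)"
  define q where "q = Im (z\<^sup>2)"
  \<comment> \<open>The conjugate of \<open>z^2 + B\<close>, divided by \<open>P\<close>.\<close>
  define X where "X = ((p *\<^sub>R Y) + (B o\<^sub>L Y), - (q *\<^sub>R Y))"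
  have PY: "p\<^sup>2 *\<^sub>R Y + (2 * p) *\<^sub>R (B o\<^sub>L Y) + (B o\<^sub>L (B o\<^sub>L Y)) + q\<^sup>2 *\<^sub>R Y = id_blinfun"
    using Y(1) unfolding Pz by (simp add: blinfun_compose_simps blinfun_compose_assoc p_def q_def)
  have sh: "pshift B (z\<^sup>2) = (p *\<^sub>R id_blinfun + B, q *\<^sub>R id_blinfun)"
    by (simp add: pshift_def cscale_def pone_def p_def q_def)
  have YB': "Y o\<^sub>L (B o\<^sub>L Z) = B o\<^sub>L (Y o\<^sub>L Z)" for Z
    by (simp add: YB flip: blinfun_compose_assoc)
  have "(2 * p) *\<^sub>R (B o\<^sub>L Y) = p *\<^sub>R (B o\<^sub>L Y) + p *\<^sub>R (B o\<^sub>L Y)"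
    by (simp only: mult_2 scaleR_add_left)
  note PY' = PY[unfolded this]
  let ?E = "p\<^sup>2 *\<^sub>R Y + (p *\<^sub>R (B o\<^sub>L Y) + p *\<^sub>R (B o\<^sub>L Y)) + (B o\<^sub>L (B o\<^sub>L Y)) + q\<^sup>2 *\<^sub>R Y"
  have "pmul (pshift B (z\<^sup>2)) X = (?E, 0)" "pmul X (pshift B (z\<^sup>2)) = (?E, 0)"
    unfolding sh X_def pmul_def fst_conv snd_conv
    by (simp_all add: blinfun_compose_simps blinfun_compose_assoc YB YB' scaleR_add_right
        power2_eq_square)
  then have "presolves B (z\<^sup>2) X" by (simp only: presolves_def pone_def PY')
  then have "\<exists>X. presolves B (z\<^sup>2) X" by (rule exI)
  then show ?thesis by (simp only: presolvent_set_def mem_Collect_eq B_def)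
qed

section \<open>Independence of the calculus\<close>

definition planar_slice :: "'n::{finite,linorder} point set \<Rightarrow> complex set" where
  "planar_slice W = {z. (Re z, Im z) \<in> planar W}"

text \<open>Comparing only the absolute values of the imaginary parts covers both a change of the
  unit and complex conjugation.\<close>

lemma slice_pt_axial:
  assumes W: "axially_symmetric W" and IJ: "norm I = 1" "norm J = 1"
    and z: "slice_pt I z \<in> W" and w: "Re w = Re z" "\<bar>Im w\<bar> = \<bar>Im z\<bar>"
  shows "slice_pt J w \<in> W"
proof -
  \<comment> \<open>Points of an axial class have a nonnegative factor before the unit, so the sign
    of \<open>Im w\<close> is moved into the unit.\<close>
  define K where "K = (if Im w \<ge> 0 then J else - J)"
  have "slice_pt J w = (fst (slice_pt I z), norm (snd (slice_pt I z)) *\<^sub>R K)"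
  proof (cases "Im w \<ge> 0")
    case True
    then show ?thesis using w IJ by (simp add: slice_pt_def K_def)
  next
    case False
    then have "Im w = - \<bar>Im z\<bar>" using w(2) by linarith
    with False w(1) IJ show ?thesis by (simp add: slice_pt_def K_def)
  qed
  moreover have "K \<in> sphere 0 1" using IJ by (simp add: K_def)
  ultimately have "slice_pt J w \<in> axial_class (slice_pt I z)" unfolding axial_class_def by blast
  with W z show ?thesis unfolding axially_symmetric_def by blast
qed

lemma slice_eq_planar_slice:
  assumes "axially_symmetric W" "norm I = 1"
  shows "slice I W = planar_slice W"
proof (intro equalityI subsetI)
  fix z assume "z \<in> slice I W"
  then have "slice_pt J z \<in> W" if "norm J = 1" for J
    using slice_pt_axial[OF assms that, of z z] by (simp add: slice_def)
  then show "z \<in> planar_slice W" by (simp add: planar_slice_def planar_def slice_pt_def)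
next
  fix z assume "z \<in> planar_slice W"
  then show "z \<in> slice I W"
    using assms(2) by (simp add: planar_slice_def planar_def slice_pt_def slice_def)
qed

lemma cnj_mem_planar_slice:
  assumes "axially_symmetric W" "z \<in> planar_slice W"
  shows "cnj z \<in> planar_slice W"
proof -
  have "slice_pt J (cnj z) \<in> W" if "norm J = 1" for J
  proof (rule slice_pt_axial[OF assms(1) that that])
    show "slice_pt J z \<in> W"
      using assms(2) that by (simp add: planar_slice_def planar_def slice_pt_def)
  qed auto
  then show ?thesis by (simp add: planar_slice_def planar_def slice_pt_def)
qed

lemma continuous_on_slice_pt: "continuous_on S (slice_pt I)"
  unfolding slice_pt_def[abs_def] by (intro continuous_intros)

lemma open_slice: "open W \<Longrightarrow> open (slice I W)"
  using open_vimage[OF _ continuous_on_slice_pt, of W I] by (simp add: slice_def vimage_def)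

lemma closure_slice_subset: "closure (slice I U) \<subseteq> slice I (closure U)"
proof (rule closure_minimal)
  show "slice I U \<subseteq> slice I (closure U)" using closure_subset by (auto simp: slice_def)
  show "closed (slice I (closure U))"
    using closed_vimage[OF closed_closure continuous_on_slice_pt, of I U]
    by (simp add: slice_def vimage_def)
qed

text \<open>The conditions on the pair are the Cauchy-Riemann equations for each coefficient of
  \<alpha> + \<i> \<beta>. They make the real derivative multiplication by the complex number formed
  from the two partial derivatives in \<open>u\<close>.\<close>

lemma cr_pair_holomorphic:
  fixes \<alpha> \<beta> :: "real \<times> real \<Rightarrow> 'n::{finite,linorder} clifford"
  assumes cr: "cr_pair W \<alpha> \<beta>"
  shows "(\<lambda>z. Complex (\<alpha> (Re z, Im z) $ A) (\<beta> (Re z, Im z) $ A)) holomorphic_on planar_slice W"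
  unfolding holomorphic_on_def
proof
  fix z assume z: "z \<in> planar_slice W"
  define D where "D = frechet_derivative \<alpha> (at (Re z, Im z))"
  define E where "E = frechet_derivative \<beta> (at (Re z, Im z))"
  have "\<alpha> differentiable (at (Re z, Im z))" "\<beta> differentiable (at (Re z, Im z))"
    and CR: "D (1, 0) = E (0, 1)" "D (0, 1) = - E (1, 0)"
    using cr z unfolding cr_pair_def planar_slice_def D_def E_def by blast+
  then have D: "(\<alpha> has_derivative D) (at (Re z, Im z))" and E: "(\<beta> has_derivative E) (at (Re z, Im z))"
    unfolding D_def E_def by (simp_all add: frechet_derivative_works)
  have pt: "((\<lambda>z. (Re z, Im z)) has_derivative (\<lambda>h. (Re h, Im h))) (at z)"
    by (intro derivative_intros)
  have comp: "((\<lambda>z. \<phi> (Re z, Im z) $ A) has_derivative (\<lambda>h. d (Re h, Im h) $ A)) (at z)"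
    if "(\<phi> has_derivative d) (at (Re z, Im z))" for \<phi> :: "real \<times> real \<Rightarrow> 'n clifford" and d
    using bounded_linear.has_derivative[OF bounded_linear_vec_nth diff_chain_at[OF pt that]]
    by (simp add: o_def)
  have lin: "d h $ A = fst h * d (1, 0) $ A + snd h * d (0, 1) $ A"
    if "(\<phi> has_derivative d) (at (Re z, Im z))" for \<phi> :: "real \<times> real \<Rightarrow> 'n clifford" and d h
  proof -
    interpret bounded_linear d using that by (rule has_derivative_bounded_linear)
    have "h = fst h *\<^sub>R (1, 0) + snd h *\<^sub>R (0, 1)" by (simp add: prod_eq_iff)
    then have "d h = fst h *\<^sub>R d (1, 0) + snd h *\<^sub>R d (0, 1)" by (metis add scaleR)
    then show ?thesis by simp
  qed
  have "((\<lambda>z. complex_of_real (\<alpha> (Re z, Im z) $ A) + \<i> * complex_of_real (\<beta> (Re z, Im z) $ A)) has_derivative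
      (\<lambda>h. complex_of_real (D (Re h, Im h) $ A) + \<i> * complex_of_real (E (Re h, Im h) $ A))) (at z)"
    by (intro derivative_intros bounded_linear.has_derivative[OF bounded_linear_of_real] comp D E)
  also have "(\<lambda>h. complex_of_real (D (Re h, Im h) $ A) + \<i> * complex_of_real (E (Re h, Im h) $ A))
      = (*) (Complex (D (1, 0) $ A) (E (1, 0) $ A))"
  proof (rule ext)
    fix h
    show "complex_of_real (D (Re h, Im h) $ A) + \<i> * complex_of_real (E (Re h, Im h) $ A)
        = Complex (D (1, 0) $ A) (E (1, 0) $ A) * h"
      by (simp add: lin[OF D, of "(Re h, Im h)"] lin[OF E, of "(Re h, Im h)"] CR complex_eq_iff)
  qed
  finally have "((\<lambda>z. Complex (\<alpha> (Re z, Im z) $ A) (\<beta> (Re z, Im z) $ A)) has_field_derivative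
      Complex (D (1, 0) $ A) (E (1, 0) $ A)) (at z)"
    by (simp add: has_field_derivative_def Complex_eq)
  from has_field_derivative_at_within[OF this]
  show "(\<lambda>z. Complex (\<alpha> (Re z, Im z) $ A) (\<beta> (Re z, Im z) $ A)) field_differentiable (at z within planar_slice W)"
    unfolding field_differentiable_def by (rule exI)
qed

definition regular_set :: "('v::real_normed_vector, 'n::{finite,linorder}) cliff_op \<Rightarrow> 'n point set \<Rightarrow> complex set" where
  "regular_set T W = {z \<in> planar_slice W. z\<^sup>2 \<in> presolvent_set (sum_of_squares T)}"

text \<open>A point is excluded from the regular set for one of two reasons. If it lies in
  \<open>W\<close> and the kernel is singular there, it belongs to the \<open>S\<close>-spectrum and
  so to \<open>U\<close>, with winding number 1; if it lies outside \<open>W\<close>, it is outside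
  the closure of \<open>U\<close>, with winding number 0.\<close>

lemma admissible_cycle:
  fixes T :: "('v::banach, 'n::{finite,linorder}) cliff_op"
  assumes T: "T \<in> BC1" and W: "axially_symmetric W" and adm: "admissible T W U I \<Gamma>"
  shows "cycle_in (regular_set T W) (\<lambda>z. if z \<in> planar_slice W then 1 else 0) \<Gamma>"
proof -
  have I: "norm I = 1" and U: "open U" "axially_symmetric U" "S_spectrum T \<subseteq> U" "closure U \<subseteq> W"
    and J: "jordan_boundary \<Gamma> (slice I U)" and pos: "positively_oriented \<Gamma> (slice I U)"
    using adm by (auto simp: admissible_def slice_cauchy_domain_def)
  have W': "slice I W = planar_slice W" by (rule slice_eq_planar_slice[OF W I])
  have clW: "closure (slice I U) \<subseteq> planar_slice W"
    using closure_slice_subset[of I U] U(4) W' by (auto simp: slice_def)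
  have spec: "z \<in> slice I U" if "z\<^sup>2 \<notin> presolvent_set (sum_of_squares T)" for z
    using presolvent_set_of_S_resolvent[OF T I, of z] that U(3) by (auto simp: slice_def)
  have "frontier (slice I U) \<subseteq> regular_set T W"
    using clW spec open_slice[OF U(1), of I] by (auto simp: frontier_def interior_open regular_set_def)
  with J have "path_image \<gamma> \<subseteq> regular_set T W" if "\<gamma> \<in> \<Gamma>" for \<gamma>
    using that by (auto simp: jordan_boundary_def)
  moreover have "(\<Sum>\<gamma>\<in>\<Gamma>. winding_number \<gamma> z) = (if z \<in> planar_slice W then 1 else 0)"
    if "z \<notin> regular_set T W" for z
  proof (cases "z \<in> planar_slice W")
    case True
    with that spec have "z \<in> slice I U" by (auto simp: regular_set_def)
    with pos True show ?thesis by (simp add: positively_oriented_def)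
  next
    case False
    with clW have "z \<notin> closure (slice I U)" by blast
    with pos False show ?thesis by (simp add: positively_oriented_def)
  qed
  ultimately show ?thesis using J by (auto simp: cycle_in_def jordan_boundary_def)
qed

text \<open>The common core of the left and the right calculus. \<open>M A\<close> absorbs what
  distinguishes them, multiplication by \<open>e_A\<close> from the right or the left, together with
  the constant of the kernel; \<open>F A\<close> is the holomorphic coefficient of the
  function.\<close>

lemma calculus_independent:
  fixes T :: "('v::banach, 'n::{finite,linorder}) cliff_op"
    and F :: "'n set \<Rightarrow> complex \<Rightarrow> complex"
    and M :: "'n set \<Rightarrow> ('v, 'n) cliff_op \<Rightarrow> ('v, 'n) cliff_op"
    and l :: nat
  defines "G \<equiv> \<lambda>A z. cscale (F A z) (ppow (presolvent (sum_of_squares T) (z\<^sup>2)) l)"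
  assumes T: "T \<in> BC1" and W: "open W" "axially_symmetric W"
    and F: "\<And>A. F A holomorphic_on planar_slice W"
    and Fc: "\<And>A z. z \<in> planar_slice W \<Longrightarrow> F A (cnj z) = cnj (F A z)"
    and M: "\<And>A. bounded_linear (M A)"
    and g: "\<And>I \<gamma> t. norm I = 1 \<Longrightarrow> \<gamma> t \<in> regular_set T W \<Longrightarrow> g I \<gamma> t
      = (\<Sum>A\<in>UNIV. M A (kappa I (cscale (- \<i>) (cscale (vector_derivative \<gamma> (at t within {0..1})) (G A (\<gamma> t))))))"
  shows "\<exists>R. \<forall>U I \<Gamma>. admissible T W U I \<Gamma> \<longrightarrow>
    (\<forall>\<gamma>\<in>\<Gamma>. (\<forall>z\<in>path_image \<gamma>. op_invertible (Qc (slice_pt I z) T)) \<and> g I \<gamma> integrable_on {0..1}) \<and>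
    (1 / (2 * pi)) *\<^sub>R (\<Sum>\<gamma>\<in>\<Gamma>. integral {0..1} (g I \<gamma>)) = R"
proof -
  let ?S = "regular_set T W" and ?B = "sum_of_squares T"
  let ?\<eta> = "\<lambda>z. if z \<in> planar_slice W then 1 else (0::complex)"
  have G: "G A weakly_holomorphic_on ?S" for A
    unfolding G_def
    by (intro weakly_holomorphic_on_cscale holomorphic_on_subset[OF F]
        weakly_holomorphic_on_compose[OF presolvent_pow_weakly_holomorphic] holomorphic_intros)
      (auto simp: regular_set_def)
  have cW: "cnj z \<in> planar_slice W \<longleftrightarrow> z \<in> planar_slice W" for z
    using cnj_mem_planar_slice[OF W(2)] by (metis complex_cnj_cnj)
  have cS: "cnj z \<in> ?S" if "z \<in> ?S" for z
    using that presolvent_cnj(1)[of "z\<^sup>2" ?B] cW by (simp add: regular_set_def)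
  then have cS': "cnj ` ?S = ?S" by (force intro: image_eqI[where x = "cnj _"])
  have Gc: "G A (cnj z) = (fst (G A z), - snd (G A z))" if "z \<in> ?S" for A z
  proof -
    have "G A (cnj z) = pconj (G A z)"
      using that Fc[of z A] presolvent_cnj(2)[of "z\<^sup>2" ?B]
      by (simp add: G_def regular_set_def pconj_cscale pconj_ppow)
    then show ?thesis by (simp add: pconj_def)
  qed
  \<comment> \<open>The value of the calculus as an expression in the cycle alone; the unit
    \<open>I\<close> does not enter.\<close>
  define P where "P \<Gamma> = (1 / (2 * pi)) *\<^sub>R (\<Sum>A\<in>UNIV. M A (axis {} (snd (\<Sum>\<gamma>\<in>\<Gamma>. cintegral \<gamma> (G A)))))" for \<Gamma>
  have main: "(\<forall>\<gamma>\<in>\<Gamma>. (\<forall>z\<in>path_image \<gamma>. op_invertible (Qc (slice_pt I z) T)) \<and> g I \<gamma> integrable_on {0..1}) \<and>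
      (1 / (2 * pi)) *\<^sub>R (\<Sum>\<gamma>\<in>\<Gamma>. integral {0..1} (g I \<gamma>)) = P \<Gamma> \<and> open ?S \<and> cycle_in ?S ?\<eta> \<Gamma>"
    if adm: "admissible T W U I \<Gamma>" for U I \<Gamma>
  proof -
    have I: "norm I = 1" using adm by (simp add: admissible_def)
    have cyc: "cycle_in ?S ?\<eta> \<Gamma>" by (rule admissible_cycle[OF T W(2) adm])
    \<comment> \<open>The planar slice is open because it equals the slice along \<open>I\<close>.
      The unit comes from admissibility, which is why openness is part of
      \<open>main\<close>.\<close>
    have S: "open ?S"
    proof -
      have "open (planar_slice W)" using open_slice[OF W(1), of I] slice_eq_planar_slice[OF W(2) I] by simp
      moreover have "open ((\<lambda>z::complex. z\<^sup>2) -` presolvent_set ?B)"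
        by (intro open_vimage open_presolvent_set continuous_intros)
      moreover have "?S = planar_slice W \<inter> (\<lambda>z::complex. z\<^sup>2) -` presolvent_set ?B"
        by (auto simp: regular_set_def)
      ultimately show ?thesis by auto
    qed
    define L where "L A = (\<lambda>p. M A (kappa I (cscale (- \<i>) p)))" for A
    have L: "bounded_linear (L A)" for A
      unfolding L_def
      by (intro bounded_linear_compose[OF M] bounded_linear_compose[OF bounded_linear_kappa]
          cscale.bounded_linear_right)
    have "(g I \<gamma> has_integral (\<Sum>A\<in>UNIV. L A (cintegral \<gamma> (G A)))) {0..1}" if \<gamma>: "\<gamma> \<in> \<Gamma>" for \<gamma>
    proof -
      have v: "valid_path \<gamma>" "path_image \<gamma> \<subseteq> ?S" using cyc \<gamma> by (auto simp: cycle_in_def)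
      have "((\<lambda>t. \<Sum>A\<in>UNIV. L A (cscale (vector_derivative \<gamma> (at t within {0..1})) (G A (\<gamma> t))))
          has_integral (\<Sum>A\<in>UNIV. L A (cintegral \<gamma> (G A)))) {0..1}"
        unfolding cintegral_def
        by (intro has_integral_sum finite
            has_integral_linear[OF integrable_integral L, unfolded o_def] cintegrable[OF S G v])
      then show ?thesis
        by (rule has_integral_eq[rotated])
          (use v(2) in \<open>auto simp: g[OF I] L_def path_image_def image_subset_iff\<close>)
    qed
    then have int: "g I \<gamma> integrable_on {0..1}"
      "integral {0..1} (g I \<gamma>) = (\<Sum>A\<in>UNIV. L A (cintegral \<gamma> (G A)))" if "\<gamma> \<in> \<Gamma>" for \<gamma>
      using that by (auto simp: integral_unique)
    have "(\<Sum>\<gamma>\<in>\<Gamma>. integral {0..1} (g I \<gamma>)) = (\<Sum>A\<in>UNIV. L A (\<Sum>\<gamma>\<in>\<Gamma>. cintegral \<gamma> (G A)))"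
      by (simp add: int(2) sum.swap[of _ UNIV] bounded_linear.linear[OF L] linear_sum)
    moreover have "L A (\<Sum>\<gamma>\<in>\<Gamma>. cintegral \<gamma> (G A)) = M A (axis {} (snd (\<Sum>\<gamma>\<in>\<Gamma>. cintegral \<gamma> (G A))))" for A
    proof -
      have "fst (\<Sum>\<gamma>\<in>\<Gamma>. cintegral \<gamma> (G A)) = 0"
        by (rule cintegral_intrinsic[OF S cS' G Gc cyc]) (auto simp: cW)
      \<comment> \<open>The integral is purely imaginary, so \<open>- \<i>\<close> turns it into a
        real element, on which \<open>kappa I\<close> is the same for every
        \<open>I\<close>.\<close>
      then have "cscale (- \<i>) (\<Sum>\<gamma>\<in>\<Gamma>. cintegral \<gamma> (G A)) = (snd (\<Sum>\<gamma>\<in>\<Gamma>. cintegral \<gamma> (G A)), 0)"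
        by (simp add: cscale_def)
      then show ?thesis by (simp add: L_def kappa_def axis_linear omul.zero_right)
    qed
    ultimately have "(1 / (2 * pi)) *\<^sub>R (\<Sum>\<gamma>\<in>\<Gamma>. integral {0..1} (g I \<gamma>)) = P \<Gamma>"
      by (simp add: P_def)
    moreover have "op_invertible (Qc (slice_pt I z) T)" if "z \<in> path_image \<gamma>" "\<gamma> \<in> \<Gamma>" for z \<gamma>
      using that cyc Qc_inverse[OF T I, of z] unfolding op_invertible_def
      by (auto simp: cycle_in_def regular_set_def subset_iff)
    ultimately show ?thesis using int(1) S cyc by blast
  qed
  have same: "P \<Gamma> = P \<Delta>" if "open ?S" "cycle_in ?S ?\<eta> \<Gamma>" "cycle_in ?S ?\<eta> \<Delta>" for \<Gamma> \<Delta>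
    using cintegral_homologous[OF that(1) G that(2,3)] by (simp add: P_def)
  show ?thesis
  \<comment> \<open>If there is no admissible contour, the claim is vacuous; otherwise the value on
    one fixed contour serves as \<open>R\<close>.\<close>
  proof (cases "\<exists>U I \<Gamma>. admissible T W U I \<Gamma>")
    case True
    then obtain U0 I0 \<Gamma>0 where 0: "admissible T W U0 I0 \<Gamma>0" by blast
    show ?thesis
      by (intro exI[of _ "P \<Gamma>0"] allI impI) (use main[OF 0] main same in metis)
  qed blast
qed

text \<open>For left functions the complex coefficients precede the basis elements, for right
  functions they follow them; in the integrand they are then adjacent to the differential, and
  \<open>kappa_pmul\<close> collects all complex factors.\<close>

lemma emb_slice_function:
  fixes I :: "'n::{finite,linorder} rvec" and a b :: "'n clifford"
  shows "(emb (a + paravec (0, I) \<star> b) :: ('v::real_normed_vector, 'n) cliff_op)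
    = (\<Sum>A\<in>UNIV. kappa I (cscale (Complex (a $ A) (b $ A)) pone) \<odot> emb (axis A 1))"
    "(emb (a + b \<star> paravec (0, I)) :: ('v::real_normed_vector, 'n) cliff_op)
    = (\<Sum>A\<in>UNIV. emb (axis A 1) \<odot> kappa I (cscale (Complex (a $ A) (b $ A)) pone))"
proof -
  have exp: "(emb c :: ('v, 'n) cliff_op) = (\<Sum>A\<in>UNIV. c $ A *\<^sub>R emb (axis A 1))" for c :: "'n clifford"
  proof -
    have "(emb c :: ('v, 'n) cliff_op) = emb (\<Sum>A\<in>UNIV. axis A (c $ A))" by (simp flip: axis_expansion)
    then show ?thesis by (simp add: emb_sum emb_axis axis_linear)
  qed
  have one: "emb (axis {} x) = (x *\<^sub>R op_one :: ('v, 'n) cliff_op)" for x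
    by (simp add: emb_axis axis_linear)
  have kap: "kappa I (cscale (Complex x y) pone)
      = (x *\<^sub>R op_one + y *\<^sub>R emb (paravec (0, I)) :: ('v, 'n) cliff_op)" for x y
    using one[of x] by (simp only: kappa_cscale_pone emb_linear complex.sel)
  show "(emb (a + paravec (0, I) \<star> b) :: ('v, 'n) cliff_op)
    = (\<Sum>A\<in>UNIV. kappa I (cscale (Complex (a $ A) (b $ A)) pone) \<odot> emb (axis A 1))"
    "(emb (a + b \<star> paravec (0, I)) :: ('v, 'n) cliff_op)
    = (\<Sum>A\<in>UNIV. emb (axis A 1) \<odot> kappa I (cscale (Complex (a $ A) (b $ A)) pone))"
    by (simp_all add: emb_linear emb_cmul exp[of a] exp[of b] kap omul.sum_right
        omul.sum_left omul.add_left omul.add_right omul.scaleR_left omul.scaleR_right sum.distrib)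
qed

theorem theorem5p10:
  fixes T :: "('v::banach, 'n::{finite,linorder}) cliff_op" and l :: nat
  assumes "odd CARD('n)"
    and "1 \<le> l" and "l \<le> hn TYPE('n)"
    and "T \<in> BC1"
    and "\<And>i. op_spectrum (T $ {i}) \<subseteq> \<real>"
  shows "(\<forall>W f. left_slice_hyperholomorphic W f \<longrightarrow>
            (\<exists>R. \<forall>U I \<Gamma>. admissible T W U I \<Gamma> \<longrightarrow>
               (\<forall>\<gamma>\<in>\<Gamma>. (\<forall>z\<in>path_image \<gamma>. op_invertible (Qc (slice_pt I z) T)) \<and>
                         left_integrand l T f I \<gamma> integrable_on {0..1}) \<and>
               left_calculus l T f I \<Gamma> = R))
       \<and> (\<forall>W f. right_slice_hyperholomorphic W f \<longrightarrow>
            (\<exists>R. \<forall>U I \<Gamma>. admissible T W U I \<Gamma> \<longrightarrow>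
               (\<forall>\<gamma>\<in>\<Gamma>. (\<forall>z\<in>path_image \<gamma>. op_invertible (Qc (slice_pt I z) T)) \<and>
                         right_integrand l T f I \<gamma> integrable_on {0..1}) \<and>
               right_calculus l T f I \<Gamma> = R))"
proof (intro conjI allI impI)
  fix W :: "'n point set" and f :: "'n point \<Rightarrow> 'n clifford"
  assume "left_slice_hyperholomorphic W f"
  then obtain \<alpha> \<beta> where W: "open W" "axially_symmetric W" and cr: "cr_pair W \<alpha> \<beta>"
    and f: "\<forall>I\<in>sphere 0 1. \<forall>(u, v)\<in>planar W. f (u, v *\<^sub>R I) = \<alpha> (u, v) + paravec (0, I) \<star> \<beta> (u, v)"
    unfolding left_slice_hyperholomorphic_def by blast
  show "\<exists>R. \<forall>U I \<Gamma>. admissible T W U I \<Gamma> \<longrightarrow>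
      (\<forall>\<gamma>\<in>\<Gamma>. (\<forall>z\<in>path_image \<gamma>. op_invertible (Qc (slice_pt I z) T)) \<and>
        left_integrand l T f I \<gamma> integrable_on {0..1}) \<and> left_calculus l T f I \<Gamma> = R"
    unfolding left_calculus_def
  proof (rule calculus_independent[where l = l, OF assms(4) W cr_pair_holomorphic[OF cr]])
    \<comment> \<open>\<alpha> is even and \<beta> odd in \<open>v\<close>, so the coefficient
      functions are intrinsic.\<close>
    show "Complex (\<alpha> (Re (cnj z), Im (cnj z)) $ A) (\<beta> (Re (cnj z), Im (cnj z)) $ A)
        = cnj (Complex (\<alpha> (Re z, Im z) $ A) (\<beta> (Re z, Im z) $ A))"
      if "z \<in> planar_slice W" for A z
      using that cr by (auto simp: cr_pair_def planar_slice_def complex_eq_iff)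
    show "bounded_linear (\<lambda>S. sigma_const TYPE('n) l *\<^sub>R (S \<odot> emb (axis A 1)) :: ('v, 'n) cliff_op)" for A
      by (intro bounded_linear_const_scaleR omul.bounded_linear_left)
    fix I :: "'n rvec" and \<gamma> :: "real \<Rightarrow> complex" and t :: real
    assume I: "norm I = 1" and \<gamma>: "\<gamma> t \<in> regular_set T W"
    then have "I \<in> sphere 0 1" "(Re (\<gamma> t), Im (\<gamma> t)) \<in> planar W"
      by (simp_all add: regular_set_def planar_slice_def)
    with f have "f (slice_pt I (\<gamma> t)) = \<alpha> (Re (\<gamma> t), Im (\<gamma> t)) + paravec (0, I) \<star> \<beta> (Re (\<gamma> t), Im (\<gamma> t))"
      by (fastforce simp: slice_pt_def)
    with \<gamma> show "left_integrand l T f I \<gamma> t = (\<Sum>A\<in>UNIV. sigma_const TYPE('n) l *\<^sub>R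
        (kappa I (cscale (- \<i>) (cscale (vector_derivative \<gamma> (at t within {0..1}))
          (cscale (Complex (\<alpha> (Re (\<gamma> t), Im (\<gamma> t)) $ A) (\<beta> (Re (\<gamma> t), Im (\<gamma> t)) $ A))
            (ppow (presolvent (sum_of_squares T) ((\<gamma> t)\<^sup>2)) l)))) \<odot> emb (axis A 1)))"
      by (simp add: left_integrand_def H_kernel_slice_pt[OF assms(4) I] regular_set_def emb_dsI[OF I]
          emb_slice_function omul.sum_right omul.scaleR_left kappa_pmul[OF I] pmul_cscale cscale_cscale mult_ac
          scaleR_sum_right flip: omul_assoc)
  qed
next
  fix W :: "'n point set" and f :: "'n point \<Rightarrow> 'n clifford"
  assume "right_slice_hyperholomorphic W f"
  then obtain \<alpha> \<beta> where W: "open W" "axially_symmetric W" and cr: "cr_pair W \<alpha> \<beta>"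
    and f: "\<forall>I\<in>sphere 0 1. \<forall>(u, v)\<in>planar W. f (u, v *\<^sub>R I) = \<alpha> (u, v) + \<beta> (u, v) \<star> paravec (0, I)"
    unfolding right_slice_hyperholomorphic_def by blast
  show "\<exists>R. \<forall>U I \<Gamma>. admissible T W U I \<Gamma> \<longrightarrow>
      (\<forall>\<gamma>\<in>\<Gamma>. (\<forall>z\<in>path_image \<gamma>. op_invertible (Qc (slice_pt I z) T)) \<and>
        right_integrand l T f I \<gamma> integrable_on {0..1}) \<and> right_calculus l T f I \<Gamma> = R"
    unfolding right_calculus_def
  proof (rule calculus_independent[where l = l, OF assms(4) W cr_pair_holomorphic[OF cr]])
    show "Complex (\<alpha> (Re (cnj z), Im (cnj z)) $ A) (\<beta> (Re (cnj z), Im (cnj z)) $ A)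
        = cnj (Complex (\<alpha> (Re z, Im z) $ A) (\<beta> (Re z, Im z) $ A))"
      if "z \<in> planar_slice W" for A z
      using that cr by (auto simp: cr_pair_def planar_slice_def complex_eq_iff)
    \<comment> \<open>In the right calculus \<open>f\<close> stands first, so \<open>e_A\<close>
      multiplies from the left.\<close>
    show "bounded_linear (\<lambda>S. sigma_const TYPE('n) l *\<^sub>R (emb (axis A 1) \<odot> S) :: ('v, 'n) cliff_op)" for A
      by (intro bounded_linear_const_scaleR omul.bounded_linear_right)
    fix I :: "'n rvec" and \<gamma> :: "real \<Rightarrow> complex" and t :: real
    assume I: "norm I = 1" and \<gamma>: "\<gamma> t \<in> regular_set T W"
    then have "I \<in> sphere 0 1" "(Re (\<gamma> t), Im (\<gamma> t)) \<in> planar W"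
      by (simp_all add: regular_set_def planar_slice_def)
    with f have "f (slice_pt I (\<gamma> t)) = \<alpha> (Re (\<gamma> t), Im (\<gamma> t)) + \<beta> (Re (\<gamma> t), Im (\<gamma> t)) \<star> paravec (0, I)"
      by (fastforce simp: slice_pt_def)
    with \<gamma> show "right_integrand l T f I \<gamma> t = (\<Sum>A\<in>UNIV. sigma_const TYPE('n) l *\<^sub>R
        (emb (axis A 1) \<odot> kappa I (cscale (- \<i>) (cscale (vector_derivative \<gamma> (at t within {0..1}))
          (cscale (Complex (\<alpha> (Re (\<gamma> t), Im (\<gamma> t)) $ A) (\<beta> (Re (\<gamma> t), Im (\<gamma> t)) $ A))
            (ppow (presolvent (sum_of_squares T) ((\<gamma> t)\<^sup>2)) l))))))"
      by (simp add: right_integrand_def H_kernel_slice_pt[OF assms(4) I] regular_set_def emb_dsI[OF I]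
          emb_slice_function omul.sum_left omul.scaleR_right kappa_pmul[OF I] pmul_cscale cscale_cscale mult_ac
          scaleR_sum_right omul_assoc)
  qed
qed

end
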